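(* Let $H$ be a complex Hilbert space and let $T$ be a bounded linear operator on $H$ which is a contraction ($\|T\|\le 1$) and is almost unitary, i.e. both $I-T^*T$ and $I-TT^*$ are trace-class operators. Then $$\operatorname{index} T \;=\; K(T^* )-K(T),$$ where $\operatorname{index} T$ is the Fredholm index of $T$ and $K(\cdot)$ denotes the curvature.
   Context: For a bounded operator $T$ on a Hilbert space $H$, $T$ is called almost unitary if both $I-T^*T$ and $I-TT^*$ are trace-class; such a $T$ is Fredholm. The Fredholm index is $\operatorname{index} T=\dim\ker T-\dim\operatorname{coker} T$. The curvature of a contraction $T$ with $I-TT^*$ trace-class is $$K(T)=\lim_{n\to\infty}\operatorname{tr}\big({T^*}^nT^n(I-TT^* )\big),$$ where $\operatorname{tr}$ is the operator trace (the limit exists). Correspondingly, applied to $T^*$ when $I-T^*T$ is trace-class, $$K(T^* )=\lim_{n\to\infty}\operatorname{tr}\big(T^n{T^*}^n(I-T^*T)\big).$$ *)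

theory Defs
  imports "HOL-Analysis.Analysis"
begin

section \<open>Complex Hilbert spaces\<close>

text \<open>The complex inner product is antilinear in its first argument. The underlying
  real Hilbert space structure is the one of the class \<open>real_inner\<close>; the two axioms
  \<open>scaleR_scaleC\<close> and \<open>inner_eq_Re_cinner\<close> say that it is induced by the
  complex structure, so in particular \<open>norm x = sqrt (Re (cinner x x))\<close>.\<close>

class complex_inner = real_inner +
  fixes scaleC :: "complex \<Rightarrow> 'a \<Rightarrow> 'a" (infixr "*\<^sub>C" 75)
    and cinner :: "'a \<Rightarrow> 'a \<Rightarrow> complex"
  assumes scaleC_add_right: "a *\<^sub>C (x + y) = a *\<^sub>C x + a *\<^sub>C y"
    and scaleC_add_left: "(a + b) *\<^sub>C x = a *\<^sub>C x + b *\<^sub>C x"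
    and scaleC_scaleC: "a *\<^sub>C b *\<^sub>C x = (a * b) *\<^sub>C x"
    and scaleC_one: "1 *\<^sub>C x = x"
    and scaleR_scaleC: "r *\<^sub>R x = complex_of_real r *\<^sub>C x"
    and cinner_commute: "cinner x y = cnj (cinner y x)"
    and cinner_add_left: "cinner (x + y) z = cinner x z + cinner y z"
    and cinner_scaleC_left: "cinner (a *\<^sub>C x) y = cnj a * cinner x y"
    and inner_eq_Re_cinner: "inner x y = Re (cinner x y)"

class chilbert_space = complex_inner + complete_space

instantiation complex :: chilbert_space
begin

definition scaleC_complex :: "complex \<Rightarrow> complex \<Rightarrow> complex" where
  "scaleC_complex a x = a * x"

definition cinner_complex :: "complex \<Rightarrow> complex \<Rightarrow> complex" where
  "cinner_complex x y = cnj x * y"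

instance
  by standard
    (auto simp: scaleC_complex_def cinner_complex_def algebra_simps scaleR_conv_of_real
      inner_complex_def)

end

text \<open>This provides the complex span and the complex dimension,
  \<open>complex_vector.span\<close> and \<open>complex_vector.dim\<close>.\<close>

global_interpretation complex_vector:
  vector_space "scaleC :: complex \<Rightarrow> 'a \<Rightarrow> 'a::complex_inner"
  by unfold_locales (rule scaleC_add_right scaleC_add_left scaleC_scaleC scaleC_one)+


section \<open>Bounded operators, trace class and trace\<close>

definition bounded_clinear :: "('a::complex_inner \<Rightarrow> 'a) \<Rightarrow> bool" where
  "bounded_clinear A \<longleftrightarrow> bounded_linear A \<and> (\<forall>c x. A (c *\<^sub>C x) = c *\<^sub>C A x)"

definition cadjoint :: "('a::complex_inner \<Rightarrow> 'a) \<Rightarrow> 'a \<Rightarrow> 'a" where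
  "cadjoint A = (THE B. \<forall>x y. cinner (B x) y = cinner x (A y))"

definition positive_op :: "('a::complex_inner \<Rightarrow> 'a) \<Rightarrow> bool" where
  "positive_op A \<longleftrightarrow> bounded_clinear A \<and> (\<forall>x. cinner x (A x) \<in> \<real>\<^sub>\<ge>\<^sub>0)"

text \<open>\<open>abs_op A\<close> is \<open>|A|\<close>, the unique positive square root of \<open>A\<^sup>*A\<close>.\<close>

definition abs_op :: "('a::complex_inner \<Rightarrow> 'a) \<Rightarrow> 'a \<Rightarrow> 'a" where
  "abs_op A = (THE P. positive_op P \<and> P \<circ> P = cadjoint A \<circ> A)"

definition is_onb :: "'a::complex_inner set \<Rightarrow> bool" where
  "is_onb E \<longleftrightarrow> (\<forall>x\<in>E. \<forall>y\<in>E. cinner x y = (if x = y then 1 else 0))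
     \<and> closure (complex_vector.span E) = UNIV"

definition trace_class :: "('a::complex_inner \<Rightarrow> 'a) \<Rightarrow> bool" where
  "trace_class A \<longleftrightarrow> bounded_clinear A
     \<and> (\<exists>E. is_onb E \<and> (\<lambda>e. cinner e (abs_op A e)) summable_on E)"

text \<open>For a trace-class operator on a Hilbert space, the sum does not depend on the
  chosen orthonormal basis.\<close>

definition trace_op :: "('a::complex_inner \<Rightarrow> 'a) \<Rightarrow> complex" where
  "trace_op A = (\<Sum>\<^sub>\<infinity>e\<in>(SOME E. is_onb E). cinner e (A e))"

definition almost_unitary :: "('a::complex_inner \<Rightarrow> 'a) \<Rightarrow> bool" where
  "almost_unitary T \<longleftrightarrow>
     trace_class (\<lambda>x. x - cadjoint T (T x)) \<and> trace_class (\<lambda>x. x - T (cadjoint T x))"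


section \<open>Fredholm index\<close>

text \<open>\<open>B\<close> is a finite set of representatives of a basis of the algebraic quotient by the
  subspace \<open>S\<close>: every coset is, in a unique way, a linear combination of the
  cosets of the elements of \<open>B\<close>. In particular distinct elements of \<open>B\<close>
  have distinct cosets.\<close>

definition quotient_basis :: "'a::complex_inner set \<Rightarrow> 'a set \<Rightarrow> bool" where
  "quotient_basis S B \<longleftrightarrow> finite B
     \<and> (\<forall>x. \<exists>!c. c \<in> B \<rightarrow>\<^sub>E (UNIV :: complex set) \<and> x - (\<Sum>b\<in>B. c b *\<^sub>C b) \<in> S)"

definition quotient_dim :: "'a::complex_inner set \<Rightarrow> nat" where
  "quotient_dim S = (THE n. \<exists>B. quotient_basis S B \<and> card B = n)"

text \<open>The value is meaningful for Fredholm operators only, that is, if kernel and cokernel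
  are finite-dimensional. Every almost unitary operator is Fredholm.\<close>

definition fredholm_index :: "('a::complex_inner \<Rightarrow> 'a) \<Rightarrow> int" where
  "fredholm_index T = int (complex_vector.dim {x. T x = 0}) - int (quotient_dim (range T))"


section \<open>Curvature\<close>

definition curvature :: "('a::complex_inner \<Rightarrow> 'a) \<Rightarrow> complex" where
  "curvature T =
     lim (\<lambda>n. trace_op (\<lambda>x. (cadjoint T ^^ n) ((T ^^ n) (x - T (cadjoint T x)))))"

end

theory Submission imports Defs begin

text \<open>Write \<open>D = I - T\<^sup>*T = R\<^sup>2\<close> and \<open>C = I - TT\<^sup>* = S\<^sup>2\<close> with \<open>R\<close>, \<open>S\<close>
  self-adjoint and Hilbert--Schmidt, and let \<open>a\<^sub>n\<close> and \<open>b\<^sub>n\<close> be the sequences that define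
  the curvatures of \<open>T\<close> and \<open>T\<^sup>*\<close>. With \<open>X = R T\<^sup>n S\<close>, cyclicity of the trace turns both
  \<open>a\<^sub>n - a\<^sub>n\<^sub>+\<^sub>1\<close> and \<open>b\<^sub>n - b\<^sub>n\<^sub>+\<^sub>1\<close> into \<open>tr (X X\<^sup>*)\<close>. Hence \<open>b\<^sub>n - a\<^sub>n\<close> is constant,
  equal to \<open>b\<^sub>0 - a\<^sub>0 = tr D - tr C\<close>.

  In the same way \<open>tr D\<^sup>n - tr C\<^sup>n\<close> does not depend on \<open>n \<ge> 1\<close>, since \<open>D T\<^sup>* = T\<^sup>* C\<close>. The
  operator \<open>D\<close> is the identity on \<open>ker T\<close> and, being compact, a strict contraction on its
  orthogonal complement. So \<open>tr D\<^sup>n\<close> tends to \<open>dim ker T\<close>, likewise \<open>tr C\<^sup>n\<close> to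
  \<open>dim ker T\<^sup>*\<close>, which is the codimension of the range of \<open>T\<close> because the Neumann series of
  \<open>C\<close> inverts \<open>TT\<^sup>*\<close> on the complement of \<open>ker T\<^sup>*\<close>.\<close>

text \<open>Makes absolutely convergent series converge, both of vectors (the Neumann series) and of
  bounded operators (the square root iteration).\<close>

instance chilbert_space \<subseteq> banach ..

section \<open>Complex inner products\<close>

lemma cinner_add_right: "cinner x (y + z) = cinner x y + cinner x (z::'a::complex_inner)"
  by (metis cinner_add_left cinner_commute complex_cnj_add)

lemma cinner_scaleC_right: "cinner x (a *\<^sub>C y) = a * cinner x (y::'a::complex_inner)"
  by (metis cinner_commute cinner_scaleC_left complex_cnj_cnj complex_cnj_mult)

lemma cinner_scaleR_right: "cinner x (r *\<^sub>R y) = of_real r * cinner x (y::'a::complex_inner)"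
  by (simp add: scaleR_scaleC cinner_scaleC_right)

lemma cinner_scaleR_left: "cinner (r *\<^sub>R x) y = of_real r * cinner x (y::'a::complex_inner)"
  by (simp add: scaleR_scaleC cinner_scaleC_left)

lemma scaleC_minus_one: "(-1) *\<^sub>C x = - (x::'a::complex_inner)"
  using scaleR_scaleC[of "-1" x] by simp

lemma cinner_zero [simp]: "cinner 0 x = 0" "cinner (x::'a::complex_inner) 0 = 0"
  using cinner_add_left[of 0 0 x] cinner_add_right[of x 0 0] by simp_all

lemma cinner_minus [simp]:
  "cinner (- x) y = - cinner x y" "cinner x (- y) = - cinner x (y::'a::complex_inner)"
  using cinner_scaleR_left[of "-1" x y] cinner_scaleR_right[of x "-1" y] by simp_all

lemma cinner_diff_left: "cinner (x - y) z = cinner x z - cinner y (z::'a::complex_inner)"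
  using cinner_add_left[of x "- y" z] by simp

lemma cinner_diff_right: "cinner x (y - z) = cinner x y - cinner x (z::'a::complex_inner)"
  using cinner_add_right[of x y "- z"] by simp

lemma cinner_sum_right: "cinner x (sum f F) = (\<Sum>i\<in>F. cinner x (f i :: 'a::complex_inner))"
  by (induction F rule: infinite_finite_induct) (auto simp: cinner_add_right)

lemma cinner_sum_left: "cinner (sum f F) x = (\<Sum>i\<in>F. cinner (f i) (x :: 'a::complex_inner))"
  by (induction F rule: infinite_finite_induct) (auto simp: cinner_add_left)

lemma cinner_self: "cinner x (x::'a::complex_inner) = of_real ((norm x)\<^sup>2)"
proof -
  have "Im (cinner x x) = 0"
    using cinner_commute[of x x] by (metis Reals_cnj_iff complex_is_Real_iff)
  then show ?thesis
    by (simp add: complex_eq_iff power2_norm_eq_inner inner_eq_Re_cinner)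
qed

lemma cinner_self_eq_0 [simp]: "cinner x x = 0 \<longleftrightarrow> (x::'a::complex_inner) = 0"
  by (simp add: cinner_self)

lemma cinner_eqI:
  assumes "\<And>z. cinner z x = cinner z (y::'a::complex_inner)"
  shows "x = y"
  using assms[of "x - y"] cinner_self_eq_0[of "x - y"] by (simp add: cinner_diff_right)

lemma cmod_cinner_commute: "cmod (cinner x y) = cmod (cinner y (x::'a::complex_inner))"
  by (metis cinner_commute complex_mod_cnj)

lemma norm_scaleC [simp]: "norm (c *\<^sub>C x) = cmod c * norm (x::'a::complex_inner)"
proof -
  have "cinner (c *\<^sub>C x) (c *\<^sub>C x) = (c * cnj c) * cinner x x"
    by (simp only: cinner_scaleC_left cinner_scaleC_right mult_ac)
  also have "\<dots> = of_real ((cmod c * norm x)\<^sup>2)"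
    by (simp add: cinner_self power_mult_distrib flip: complex_norm_square)
  finally have "(norm (c *\<^sub>C x))\<^sup>2 = (cmod c * norm x)\<^sup>2"
    unfolding cinner_self of_real_eq_iff .
  then show ?thesis by simp
qed

text \<open>A unit scalar \<open>c\<close> rotates \<open>y\<close> so that the inner product
  becomes real and nonnegative; the real Cauchy-Schwarz inequality then applies.\<close>

lemma cmod_cinner_le: "cmod (cinner x y) \<le> norm x * norm (y::'a::complex_inner)"
proof (cases "cinner x y = 0")
  case False
  define c where "c = cnj (cinner x y) / of_real (cmod (cinner x y))"
  have c: "cmod c = 1" using False by (simp add: c_def norm_divide)
  have "c * cinner x y = of_real (cmod (cinner x y))"
    using False
    by (simp add: c_def field_simps flip: complex_norm_square)
       (simp add: power2_eq_square)
  then have "cmod (cinner x y) = inner x (c *\<^sub>C y)"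
    by (simp add: inner_eq_Re_cinner cinner_scaleC_right)
  also have "\<dots> \<le> norm x * norm (c *\<^sub>C y)" by (rule norm_cauchy_schwarz)
  finally show ?thesis using c by simp
qed simp

lemma bounded_linear_cinner_right: "bounded_linear (cinner (x::'a::complex_inner))"
  by (rule bounded_linear_intro[of _ "norm x"])
     (use cmod_cinner_le[of x] in
      \<open>auto simp: cinner_add_right cinner_scaleR_right scaleR_conv_of_real mult.commute\<close>)

lemma bounded_linear_cinner_left: "bounded_linear (\<lambda>x. cinner x (y::'a::complex_inner))"
  by (rule bounded_linear_intro[of _ "norm y"])
     (use cmod_cinner_le[of _ y] in
      \<open>auto simp: cinner_add_left cinner_scaleR_left scaleR_conv_of_real\<close>)

lemma norm_diff_sq:
  "(norm (x - y))\<^sup>2 = (norm x)\<^sup>2 - 2 * Re (cinner x y) + (norm (y::'a::complex_inner))\<^sup>2"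
  by (simp add: power2_norm_eq_inner inner_diff_left inner_diff_right inner_commute
      flip: inner_eq_Re_cinner)

section \<open>Adjoints\<close>

lemma riesz_representation:
  fixes f :: "'a::{real_inner,complete_space} \<Rightarrow> real"
  assumes "bounded_linear f"
  shows "\<exists>y. \<forall>x. f x = inner y x"
proof -
  \<comment> \<open>The representing vector is the minimizer of this functional.\<close>
  define J where "J x = (norm x)\<^sup>2 - 2 * f x" for x
  interpret f: bounded_linear f by fact
  obtain K where K: "\<And>x. norm (f x) \<le> norm x * K" using f.bounded by blast
  have lb: "J x \<ge> - K\<^sup>2" for x
  proof -
    have "0 \<le> (norm x - K)\<^sup>2" by simp
    with K[of x] show ?thesis by (simp add: J_def power2_diff)
  qed
  define m where "m = Inf (range J)"
  have bdd: "bdd_below (range J)" by (rule bdd_belowI2) (rule lb)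
  have m: "m \<le> J x" for x unfolding m_def using bdd by (intro cInf_lower) auto
  have "\<exists>x. J x < m + 1 / real (Suc n)" for n
    using cInf_lessD[of "range J" "m + 1 / real (Suc n)"] by (auto simp: m_def)
  then obtain s where s: "\<And>n. J (s n) < m + 1 / real (Suc n)" by metis
  \<comment> \<open>Parallelogram law: the linear parts of \<open>J\<close> cancel, so vectors at
    which \<open>J\<close> is close to its infimum are close to each other.\<close>
  have par: "(norm (x - y))\<^sup>2 = 2 * (J x + J y - 2 * J ((1/2) *\<^sub>R (x + y)))" for x y
    by (simp add: J_def f.scaleR f.add power2_norm_eq_inner inner_diff_left inner_diff_right
        inner_add_left inner_add_right inner_commute power_divide add_divide_distrib)
  have "Cauchy s"
  proof (rule metric_CauchyI)
    fix e :: real assume "e > 0"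
    then have "e\<^sup>2 / 4 > 0" by simp
    then obtain N where N: "1 / real (Suc N) < e\<^sup>2 / 4"
      using nat_approx_posE by blast
    have "dist (s i) (s j) < e" if "i \<ge> N" "j \<ge> N" for i j
    proof -
      have small: "1 / real (Suc k) \<le> 1 / real (Suc N)" if "k \<ge> N" for k
        using that by (simp add: frac_le)
      have "(norm (s i - s j))\<^sup>2 \<le> 2 * (J (s i) + J (s j) - 2 * m)"
        using m[of "(1/2) *\<^sub>R (s i + s j)"] by (subst par) auto
      also have "\<dots> < e\<^sup>2"
        using s[of i] s[of j] small[OF that(1)] small[OF that(2)] N by argo
      finally show ?thesis
        using \<open>e > 0\<close> by (simp add: dist_norm power2_less_imp_less)
    qed
    then show "\<exists>M. \<forall>m\<ge>M. \<forall>n\<ge>M. dist (s m) (s n) < e" by blast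
  qed
  then obtain y where y: "s \<longlonglongrightarrow> y" by (meson Cauchy_convergent convergent_def)
  have "(\<lambda>n. J (s n)) \<longlonglongrightarrow> J y"
    unfolding J_def by (intro tendsto_intros y f.tendsto)
  moreover have "(\<lambda>n. m + 1 / real (Suc n)) \<longlonglongrightarrow> m + 0"
    by (intro tendsto_add tendsto_const LIMSEQ_Suc lim_const_over_n)
  ultimately have "J y \<le> m + 0"
    using s by (intro LIMSEQ_le) (auto intro: less_imp_le)
  then have min: "J y \<le> J z" for z using m[of z] by simp
  have "inner y h = f h" for h
  proof (cases "h = 0")
    case False
    define a where "a = inner y h - f h"
    \<comment> \<open>This \<open>t\<close> minimizes the quadratic
      \<open>2 * t * a + t\<^sup>2 * (norm h)\<^sup>2\<close>; minimality of \<open>y\<close> then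
      forces \<open>a = 0\<close>.\<close>
    define t where "t = - a / (norm h)\<^sup>2"
    have "J (y + t *\<^sub>R h) = J y + 2 * t * a + t\<^sup>2 * (norm h)\<^sup>2"
      by (simp add: J_def a_def f.add f.scaleR power2_norm_eq_inner inner_add_left inner_add_right
          inner_commute)
        (simp add: power2_eq_square algebra_simps)
    then have "0 \<le> 2 * t * a + t\<^sup>2 * (norm h)\<^sup>2" using min[of "y + t *\<^sub>R h"] by simp
    also have "2 * t * a + t\<^sup>2 * (norm h)\<^sup>2 = - (a\<^sup>2 / (norm h)\<^sup>2)"
      using False by (simp add: t_def field_simps power2_eq_square)
    finally have "a\<^sup>2 / (norm h)\<^sup>2 \<le> 0" by simp
    then have "a = 0" using False by (simp add: divide_le_0_iff)
    then show ?thesis by (simp add: a_def)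
  qed simp
  then show ?thesis by metis
qed

text \<open>\<open>cadjoint\<close> is a definite description; a relation that carries the adjoint
  and its boundedness along composes without existence arguments. Self-adjointness reads
  \<open>adj_pair A A\<close>.\<close>

definition adj_pair :: "('a::complex_inner \<Rightarrow> 'a) \<Rightarrow> ('a \<Rightarrow> 'a) \<Rightarrow> bool" where
  "adj_pair A B \<longleftrightarrow> bounded_clinear A \<and> bounded_clinear B
     \<and> (\<forall>x y. cinner (B x) y = cinner x (A y))"

lemma bounded_clinearD:
  assumes "bounded_clinear A"
  shows "bounded_linear A" "A (c *\<^sub>C x) = c *\<^sub>C A x" "A (x + y) = A x + A y"
    "A (x - y) = A x - A y" "A 0 = 0" "A (sum f F) = (\<Sum>i\<in>F. A (f i))"
proof -
  show bl: "bounded_linear A" and "A (c *\<^sub>C x) = c *\<^sub>C A x"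
    using assms by (auto simp: bounded_clinear_def)
  show "A (x + y) = A x + A y" "A (x - y) = A x - A y" "A 0 = 0"
     "A (sum f F) = (\<Sum>i\<in>F. A (f i))"
    using bounded_linear.linear[OF bl]
    by (simp_all add: linear_add linear_diff linear_0 linear_sum)
qed

lemma bounded_clinear_id: "bounded_clinear (\<lambda>x. x)"
  by (simp add: bounded_clinear_def)

lemma bounded_clinear_comp:
  "bounded_clinear A \<Longrightarrow> bounded_clinear B \<Longrightarrow> bounded_clinear (\<lambda>x. A (B x))"
  by (auto simp: bounded_clinear_def bounded_linear_compose)

lemma bounded_clinear_diff:
  "bounded_clinear A \<Longrightarrow> bounded_clinear B \<Longrightarrow> bounded_clinear (\<lambda>x. A x - B x)"
  by (auto simp: bounded_clinear_def bounded_linear_sub complex_vector.scale_right_diff_distrib)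

lemma adj_pairD:
  assumes "adj_pair A B"
  shows "bounded_clinear A" "bounded_clinear B"
    "cinner (B x) y = cinner x (A y)" "cinner (A x) y = cinner x (B y)"
  using assms by (auto simp: adj_pair_def) (metis cinner_commute)

lemma adj_pair_sym: "adj_pair A B \<Longrightarrow> adj_pair B A"
  unfolding adj_pair_def by (metis cinner_commute)

lemma adj_pair_id: "adj_pair (\<lambda>x. x) (\<lambda>x. x)"
  by (simp add: adj_pair_def bounded_clinear_id)

lemma adj_pair_comp:
  "adj_pair A A' \<Longrightarrow> adj_pair B B' \<Longrightarrow> adj_pair (\<lambda>x. A (B x)) (\<lambda>x. B' (A' x))"
  by (auto simp: adj_pair_def bounded_clinear_comp)

lemma adj_pair_diff:
  "adj_pair A A' \<Longrightarrow> adj_pair B B' \<Longrightarrow> adj_pair (\<lambda>x. A x - B x) (\<lambda>x. A' x - B' x)"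
  by (auto simp: adj_pair_def bounded_clinear_diff cinner_diff_left cinner_diff_right)

lemma adj_pair_funpow: "adj_pair A A' \<Longrightarrow> adj_pair (A ^^ n) (A' ^^ n)"
proof (induction n)
  case 0 show ?case using adj_pair_id by (simp add: id_def)
next
  case (Suc n) then show ?case
    using adj_pair_comp[of A A' "A ^^ n" "A' ^^ n"] by (simp add: o_def funpow_swap1)
qed

text \<open>Riesz representation of the real functionals \<open>\<lambda>y. inner x (A y)\<close>;
  complex linearity of \<open>A\<close> upgrades the real adjoint to the complex one.\<close>

lemma adj_pair_exists:
  fixes A :: "'a::chilbert_space \<Rightarrow> 'a"
  assumes A: "bounded_clinear A"
  shows "\<exists>B. adj_pair A B"
proof -
  note bl = bounded_clinearD(1)[OF A]
  have "\<exists>z. \<forall>y. inner x (A y) = inner z y" for x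
    by (rule riesz_representation) (intro bounded_linear_inner_right_comp bl)
  then obtain B where B: "\<And>x y. inner x (A y) = inner (B x) y" by metis
  have cB: "cinner (B x) y = cinner x (A y)" for x y
  proof (rule complex_eqI)
    show "Re (cinner (B x) y) = Re (cinner x (A y))"
      using B[of x y] by (simp add: inner_eq_Re_cinner)
    \<comment> \<open>The imaginary part is minus the real part after multiplication by \<i>, so the
      real identity is tested at \<i> times \<open>y\<close>.\<close>
    show "Im (cinner (B x) y) = Im (cinner x (A y))"
      using B[of x "\<i> *\<^sub>C y"]
      by (simp add: inner_eq_Re_cinner bounded_clinearD[OF A] cinner_scaleC_right)
  qed
  obtain K where K: "\<And>x. norm (A x) \<le> norm x * K" and "K \<ge> 0"
    using bounded_linear.nonneg_bounded[OF bl] by blast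
  have lin: "B (x + y) = B x + B y" "B (c *\<^sub>C x) = c *\<^sub>C B x" for x y c
    by (rule cinner_eqI; subst (1 2) cinner_commute;
        simp add: cB cinner_add_left cinner_scaleC_left)+
  have "norm (B x) \<le> norm x * K" for x
  proof (cases "B x = 0")
    case False
    have "norm (B x) * norm (B x) = inner x (A (B x))"
      by (simp add: B flip: power2_norm_eq_inner power2_eq_square)
    also have "\<dots> \<le> norm x * norm (A (B x))" by (rule norm_cauchy_schwarz)
    also have "\<dots> \<le> norm x * (norm (B x) * K)" by (intro mult_left_mono K) auto
    finally show ?thesis using False by (simp add: mult.left_commute)
  qed (use \<open>K \<ge> 0\<close> in simp)
  then have "bounded_clinear B"
    unfolding bounded_clinear_def
    by (auto simp: lin scaleR_scaleC intro!: bounded_linear_intro[of _ K])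
  then show ?thesis using A cB by (auto simp: adj_pair_def)
qed

lemma cadjoint_eqI:
  assumes "adj_pair A B"
  shows "cadjoint A = B"
  unfolding cadjoint_def
proof (rule the_equality)
  show "\<forall>x y. cinner (B x) y = cinner x (A y)" using assms by (simp add: adj_pair_def)
next
  fix C assume C: "\<forall>x y. cinner (C x) y = cinner x (A y)"
  show "C = B"
  proof (rule ext, rule cinner_eqI)
    fix x z show "cinner z (C x) = cinner z (B x)"
      using C adj_pairD(3)[OF assms] by (metis cinner_commute)
  qed
qed

lemma adj_pair_cadjoint:
  "bounded_clinear A \<Longrightarrow> adj_pair A (cadjoint (A :: 'a::chilbert_space \<Rightarrow> 'a))"
  using adj_pair_exists cadjoint_eqI by metis

section \<open>Square roots of positive operators\<close>

text \<open>Polarization: the diagonal values are real, so expanding at \<open>x + y\<close>, and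
  again with \<open>y\<close> multiplied by \<i>, gives hermitian symmetry.\<close>

lemma positive_op_adj_pair:
  fixes A :: "'a::complex_inner \<Rightarrow> 'a"
  assumes "positive_op A"
  shows "adj_pair A A"
proof -
  note bl = bounded_clinearD[of A]
  have A: "bounded_clinear A" and real: "\<And>x. cinner x (A x) \<in> \<real>\<^sub>\<ge>\<^sub>0"
    using assms by (auto simp: positive_op_def)
  have im: "Im (cinner x (A x)) = 0" for x
    using real[of x] by (simp add: complex_nonneg_Reals_iff)
  have 1: "Im (cinner x (A y)) + Im (cinner y (A x)) = 0" for x y
    using im[of "x + y"] im[of x] im[of y] by (simp add: bl A cinner_add_left cinner_add_right)
  have 2: "Re (cinner x (A y)) = Re (cinner y (A x))" for x y
    using 1[of x "\<i> *\<^sub>C y"] by (simp add: bl A cinner_scaleC_left cinner_scaleC_right)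
  have "cinner (A x) y = cinner x (A y)" for x y
    using 1[of x y] 2[of x y] cinner_commute[of "A x" y] by (simp add: complex_eq_iff)
  then show ?thesis using A by (simp add: adj_pair_def)
qed

lemma adj_pair_inner: "adj_pair A B \<Longrightarrow> inner (B x) y = inner x (A y)"
  by (simp add: inner_eq_Re_cinner adj_pairD(3))

text \<open>The norm of a self-adjoint operator is bounded by its numerical radius: polarization
  expresses the mixed term by diagonal ones, and the parallelogram law sums their bounds.\<close>

lemma inner_numerical_bound:
  fixes X :: "'a::complex_inner \<Rightarrow> 'a"
  assumes X: "adj_pair X X" and m: "\<And>x. \<bar>inner x (X x)\<bar> \<le> m * (norm x)\<^sup>2"
  shows "norm (X x) \<le> m * norm x"
proof (cases "X x = 0 \<or> x = 0")
  case True
  have "0 \<le> m" if "x \<noteq> 0"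
    using order_trans[OF abs_ge_zero m[of x]] that by (simp add: zero_le_mult_iff)
  with True show ?thesis using bounded_clinearD(5)[OF adj_pairD(1)[OF X]] by (cases "x = 0") auto
next
  case False
  note bl = bounded_clinearD[OF adj_pairD(1)[OF X]]
  \<comment> \<open>With this scaling \<open>y\<close> has the length of \<open>x\<close> and the
    direction of \<open>X x\<close>, so \<open>inner (X x) y\<close> is the product of the norms of
    \<open>x\<close> and \<open>X x\<close>.\<close>
  define t where "t = norm x / norm (X x)"
  define y where "y = t *\<^sub>R X x"
  have t: "t > 0" and ny: "norm y = norm x" using False by (auto simp: t_def y_def)
  have "4 * inner (X x) y = inner (x + y) (X (x + y)) - inner (x - y) (X (x - y))"
    using adj_pair_inner[OF X, of x y]
    by (simp add: bl inner_add_left inner_add_right inner_diff_left inner_diff_right inner_commute)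
  also have "\<dots> \<le> m * (norm (x + y))\<^sup>2 + m * (norm (x - y))\<^sup>2"
    using m[of "x + y"] m[of "x - y"] by linarith
  also have "\<dots> = m * (2 * (norm x)\<^sup>2 + 2 * (norm y)\<^sup>2)"
    by (simp add: power2_norm_eq_inner inner_add_left inner_add_right inner_diff_left
        inner_diff_right algebra_simps)
  finally have "inner (X x) y \<le> m * (norm x)\<^sup>2" by (simp add: ny)
  also have "inner (X x) y = norm x * norm (X x)"
    using False by (simp add: y_def t_def power2_eq_square flip: power2_norm_eq_inner)
  finally show ?thesis using False by (simp add: power2_eq_square)
qed

text \<open>The difference \<open>X = P - Q\<close> satisfies \<open>P X + X Q = 0\<close>. On approximate
  eigenvectors for \<open>\<plusminus>\<parallel>X\<parallel>\<close> this makes the quadratic forms of \<open>P\<close> and \<open>Q\<close>,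
  and hence that of \<open>X\<close>, small.\<close>

lemma positive_square_root_unique:
  fixes P Q :: "'a::complex_inner \<Rightarrow> 'a"
  assumes P: "positive_op P" and Q: "positive_op Q" and eq: "\<And>x. P (P x) = Q (Q x)"
  shows "P = Q"
proof -
  note aP = positive_op_adj_pair[OF P] and aQ = positive_op_adj_pair[OF Q]
  define X where "X x = P x - Q x" for x
  have aX: "adj_pair X X" unfolding X_def by (intro adj_pair_diff aP aQ)
  note blP = bounded_clinearD[OF adj_pairD(1)[OF aP]]
  note blX = bounded_clinearD[OF adj_pairD(1)[OF aX]]
  have posP: "inner x (P x) \<ge> 0" and posQ: "inner x (Q x) \<ge> 0" for x
    using P Q by (auto simp: positive_op_def inner_eq_Re_cinner complex_nonneg_Reals_iff)
  have anti: "P (X x) = - X (Q x)" for x by (simp add: X_def blP eq)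
  define M where "M = onorm X"
  have M: "norm (X x) \<le> M * norm x" for x unfolding M_def by (rule onorm) (rule blX)
  have "M \<ge> 0" unfolding M_def by (rule onorm_pos_le) (rule blX)
  have "M = 0"
  proof (rule ccontr)
    assume "M \<noteq> 0"
    with \<open>M \<ge> 0\<close> have M0: "M > 0" by simp
    \<comment> \<open>By the numerical radius bound, unit vectors exist on which the quadratic form
      of \<open>X\<close> nearly attains the norm \<open>M\<close>.\<close>
    have nbd: "\<exists>x. norm x = 1 \<and> \<bar>inner x (X x)\<bar> > M * (1 - e)" if "e > 0" "e < 1" for e
    proof (rule ccontr)
      assume contra: "\<not> ?thesis"
      have "\<bar>inner x (X x)\<bar> \<le> M * (1 - e) * (norm x)\<^sup>2" for x
      proof (cases "x = 0")
        case False
        define u where "u = (1 / norm x) *\<^sub>R x"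
        have x: "x = norm x *\<^sub>R u" and "norm u = 1" using False by (auto simp: u_def)
        then have "\<bar>inner u (X u)\<bar> \<le> M * (1 - e)" using contra by force
        have Xx: "X x = norm x *\<^sub>R X u"
          by (subst x) (simp add: scaleR_scaleC blX)
        have "inner x (X x) = (norm x)\<^sup>2 * inner u (X u)"
          by (subst Xx, subst (1) x) (simp add: power2_eq_square)
        then show ?thesis
          using \<open>\<bar>inner u (X u)\<bar> \<le> M * (1 - e)\<close> False
          by (simp add: abs_mult mult.commute)
      qed simp
      then have "norm (X x) \<le> M * (1 - e) * norm x" for x
        by (rule inner_numerical_bound[OF aX])
      then have "M \<le> M * (1 - e)"
        unfolding M_def by (intro onorm_bound) (use that \<open>M \<ge> 0\<close> M_def in auto)
      then have "M * e \<le> 0" by (simp add: algebra_simps)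
      with M0 that show False by (simp add: mult_le_0_iff)
    qed
    define C where "C = M + onorm P + onorm Q"
    have C: "norm (P x) \<le> C * norm x" "norm (Q x) \<le> C * norm x" for x
    proof -
      have "norm (P x) \<le> onorm P * norm x" "norm (Q x) \<le> onorm Q * norm x"
        by (intro onorm blP bounded_clinearD(1)[OF adj_pairD(1)[OF aQ]])+
      moreover have "onorm P \<le> C" "onorm Q \<le> C"
        using \<open>M \<ge> 0\<close> onorm_pos_le[OF blP(1)]
          onorm_pos_le[OF bounded_clinearD(1)[OF adj_pairD(1)[OF aQ]]] by (auto simp: C_def)
      ultimately show "norm (P x) \<le> C * norm x" "norm (Q x) \<le> C * norm x"
        by (meson mult_right_mono norm_ge_zero order_trans)+
    qed
    have bound: "M * (1 - e) < 2 * C * sqrt (2 * e)" if e: "e > 0" "e < 1" for e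
    proof -
      obtain x where nx: "norm x = 1" and x: "\<bar>inner x (X x)\<bar> > M * (1 - e)"
        using nbd[OF e] by blast
      \<comment> \<open>\<open>l\<close> is the approximate eigenvalue, \<open>M\<close> with the
        sign of the quadratic form; the residual \<open>r\<close> turns out to be of order
        \<open>sqrt e\<close>.\<close>
      define l where "l = (if inner x (X x) \<ge> 0 then M else - M)"
      have l: "l * inner x (X x) = M * \<bar>inner x (X x)\<bar>" "\<bar>l\<bar> = M" using M0 by (auto simp: l_def)
      define r where "r = X x - l *\<^sub>R x"
      have "(norm r)\<^sup>2 = (norm (X x))\<^sup>2 - 2 * l * inner x (X x) + l\<^sup>2"
        using nx
        by (simp add: r_def norm_diff_sq power_mult_distrib flip: inner_eq_Re_cinner)
           (simp add: inner_commute)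
      also have "\<dots> \<le> M\<^sup>2 - 2 * M * (M * (1 - e)) + M\<^sup>2"
      proof -
        have "(norm (X x))\<^sup>2 \<le> M\<^sup>2" using M[of x] nx by (simp add: power_mono)
        moreover have "l\<^sup>2 = M\<^sup>2" using l(2) by (metis power2_abs)
        moreover have "M * (M * (1 - e)) \<le> M * \<bar>inner x (X x)\<bar>"
          using x M0 by (intro mult_left_mono) auto
        ultimately show ?thesis using l(1) by linarith
      qed
      also have "\<dots> = M\<^sup>2 * (2 * e)" by (simp add: power2_eq_square algebra_simps)
      finally have "norm r \<le> sqrt (M\<^sup>2 * (2 * e))" by (rule real_le_rsqrt)
      then have nr: "norm r \<le> M * sqrt (2 * e)" using M0 by (simp add: real_sqrt_mult)
      have Xx: "X x = l *\<^sub>R x + r" by (simp add: r_def)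
      \<comment> \<open>The identity \<open>P X + X Q = 0\<close> paired with \<open>x\<close>;
        substituting \<open>X x = l x + r\<close> leaves the forms of \<open>P\<close> and
        \<open>Q\<close> against terms in \<open>r\<close> only.\<close>
      have "inner x (P (X x)) + inner (X x) (Q x) = 0"
        using anti[of x] adj_pair_inner[OF aX, of x "Q x"] by simp
      also have "P (X x) = l *\<^sub>R P x + P r" by (simp add: Xx scaleR_scaleC blP)
      also have "inner (X x) (Q x) = l * inner x (Q x) + inner r (Q x)"
        by (simp add: Xx inner_add_left)
      finally have "l * (inner x (P x) + inner x (Q x)) = - inner x (P r) - inner r (Q x)"
        by (simp add: inner_add_right algebra_simps)
      then have "M * (inner x (P x) + inner x (Q x)) = \<bar>- inner x (P r) - inner r (Q x)\<bar>"
        using l(2) posP[of x] posQ[of x] by (simp add: abs_mult flip: \<open>l * (_ + _) = _\<close>)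
      also have "\<dots> \<le> \<bar>inner x (P r)\<bar> + \<bar>inner r (Q x)\<bar>" by linarith
      also have "\<dots> \<le> C * norm r + norm r * C"
        using Cauchy_Schwarz_ineq2[of x "P r"] Cauchy_Schwarz_ineq2[of r "Q x"] C(1)[of r]
          mult_left_mono[OF C(2)[of x], of "norm r"] nx by (simp add: mult.commute)
      also have "\<dots> \<le> M * (2 * C * sqrt (2 * e))"
        using mult_left_mono[OF nr, of C] order_trans[OF norm_ge_zero C(1)[of x]] nx
        by (simp add: mult_ac)
      finally have "inner x (P x) + inner x (Q x) \<le> 2 * C * sqrt (2 * e)" using M0 by simp
      moreover have "\<bar>inner x (X x)\<bar> \<le> inner x (P x) + inner x (Q x)"
        using posP[of x] posQ[of x] by (simp add: X_def inner_diff_right)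
      ultimately show ?thesis using x by linarith
    qed
    \<comment> \<open>As \<open>e\<close> tends to 0 the left side tends to \<open>M > 0\<close> and
      the right side to 0.\<close>
    have ev: "\<forall>\<^sub>F e in at_right 0. M * (1 - e) \<le> 2 * C * sqrt (2 * e)"
      using eventually_at_right_real[of 0 1] bound
      by (auto elim!: eventually_mono intro!: less_imp_le)
    have t1: "((\<lambda>e. M * (1 - e)) \<longlongrightarrow> M * (1 - 0)) (at_right 0)"
      by (intro tendsto_intros)
    have t2: "((\<lambda>e. 2 * C * sqrt (2 * e)) \<longlongrightarrow> 2 * C * sqrt (2 * 0)) (at_right 0)"
      by (intro tendsto_intros)
    have "M * (1 - 0) \<le> 2 * C * sqrt (2 * 0)"
      by (rule tendsto_le[OF _ t2 t1 ev]) simp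
    with M0 show False by simp
  qed
  then show ?thesis using M by (intro ext) (simp add: X_def)
qed

text \<open>Uniqueness of the positive square root resolves the description in
  \<open>abs_op\<close>. Thus trace class membership of a positive defect operator becomes a
  statement about its own diagonal sum.\<close>

lemma abs_op_positive:
  assumes A: "positive_op A"
  shows "abs_op A = A"
  unfolding abs_op_def
proof (rule the_equality)
  have c: "cadjoint A = A" by (rule cadjoint_eqI[OF positive_op_adj_pair[OF A]])
  show "positive_op A \<and> A \<circ> A = cadjoint A \<circ> A" using A c by simp
  fix P assume "positive_op P \<and> P \<circ> P = cadjoint A \<circ> A"
  then show "P = A" using c A
    by (intro positive_square_root_unique) (auto simp: fun_eq_iff)
qed

text \<open>With \<open>B\<close> self-adjoint and \<open>\<parallel>B\<parallel> \<le> 1\<close>, the limit \<open>Y\<close> of the iteration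
  \<open>Y\<^sub>0 = 0\<close>, \<open>2 Y\<^sub>n\<^sub>+\<^sub>1 = B + Y\<^sub>n\<^sup>2\<close> satisfies \<open>(1 - Y)\<^sup>2 = 1 - B\<close>. It exists because the
  increments are dominated by those of the same iteration for the number \<open>1\<close>.\<close>

lemma square_root_one_minus:
  fixes B :: "'a::chilbert_space \<Rightarrow> 'a"
  assumes B: "adj_pair B B" and B1: "\<And>x. norm (B x) \<le> norm x"
  obtains R where "adj_pair R R" "\<And>x. R (R x) = x - B x"
proof -
  note blB = bounded_clinearD[OF adj_pairD(1)[OF B]]
  \<comment> \<open>The iteration runs in the Banach space of bounded operators, where convergence
    can be read off from norms.\<close>
  define b where "b = Blinfun B"
  have b: "blinfun_apply b = B" unfolding b_def by (rule bounded_linear_Blinfun_apply) (rule blB)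
  have nb: "norm b \<le> 1" by (rule norm_blinfun_bound) (simp_all add: b B1)
  define Y where "Y n = ((\<lambda>y. (1/2) *\<^sub>R (b + (y o\<^sub>L y))) ^^ n) 0" for n
  define t where "t n = ((\<lambda>s::real. (1 + s\<^sup>2) / 2) ^^ n) 0" for n
  have Y0: "Y 0 = 0" and YS: "\<And>n. Y (Suc n) = (1/2) *\<^sub>R (b + (Y n o\<^sub>L Y n))" by (auto simp: Y_def)
  have t0: "t 0 = 0" and tS: "\<And>n. t (Suc n) = (1 + (t n)\<^sup>2) / 2" by (auto simp: t_def)
  have t01: "0 \<le> t n \<and> t n \<le> 1" for n
    by (induction n) (auto simp: t0 tS power_le_one)
  have key: "norm (Y n) \<le> t n \<and> norm (Y (Suc n) - Y n) \<le> t (Suc n) - t n" for n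
  proof (induction n)
    case 0 show ?case using nb by (simp add: Y0 t0 YS tS)
  next
    case (Suc n)
    have mono: "t n \<le> t (Suc n)" using order_trans[OF norm_ge_zero conjunct2[OF Suc.IH]] by simp
    have a: "norm (Y (Suc n)) \<le> t (Suc n)"
      using Suc norm_triangle_sub[of "Y (Suc n)" "Y n"] by linarith
    \<comment> \<open>The difference of two squares without commutativity:
      \<open>A A - B B = A (A - B) + (A - B) B\<close>.\<close>
    have split: "Y (Suc (Suc n)) - Y (Suc n)
        = (1/2) *\<^sub>R ((Y (Suc n) o\<^sub>L (Y (Suc n) - Y n)) + ((Y (Suc n) - Y n) o\<^sub>L Y n))"
      unfolding YS[of "Suc n"] by (subst (2) YS)
        (rule blinfun_eqI, simp add: blinfun.bilinear_simps algebra_simps)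
    have "norm (Y (Suc (Suc n)) - Y (Suc n))
        \<le> (1/2) * (norm (Y (Suc n)) * norm (Y (Suc n) - Y n)
            + norm (Y (Suc n) - Y n) * norm (Y n))"
      unfolding split norm_scaleR
      using norm_triangle_mono[OF norm_blinfun_compose norm_blinfun_compose] by simp
    also have "\<dots> \<le> (1/2) * (t (Suc n) * (t (Suc n) - t n) + (t (Suc n) - t n) * t n)"
      using Suc a mono t01[of n] t01[of "Suc n"]
      by (intro mult_left_mono add_mono mult_mono) (auto intro: order_trans[OF norm_ge_zero])
    also have "\<dots> = t (Suc (Suc n)) - t (Suc n)"
      by (simp add: tS[of "Suc n"], subst (5) tS) (simp add: power2_eq_square algebra_simps)
    finally show ?case using a by blast
  qed
  \<comment> \<open>The scalar sequence increases and stays below 1, so its increments are summable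
    and dominate those of \<open>Y\<close>.\<close>
  have "incseq t" using key by (intro incseq_SucI) (smt (verit) norm_ge_zero)
  then obtain L where "t \<longlonglongrightarrow> L" using t01 incseq_convergent[of t 1] by blast
  then have "summable (\<lambda>n. t (Suc n) - t n)" by (rule telescope_summable)
  then have "summable (\<lambda>n. norm (Y (Suc n) - Y n))"
    by (rule summable_comparison_test') (use key in auto)
  then have "summable (\<lambda>n. Y (Suc n) - Y n)" by (rule summable_norm_cancel)
  then obtain s where "(\<lambda>n. (Y (Suc n) - Y n)) sums s" by (auto simp: summable_def)
  then have "(\<lambda>n. \<Sum>i<n. Y (Suc i) - Y i) \<longlonglongrightarrow> s" by (simp add: sums_def)
  then have Ys: "Y \<longlonglongrightarrow> s" by (simp add: sum_lessThan_telescope Y0)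
  have "(\<lambda>n. Y (Suc n)) \<longlonglongrightarrow> (1/2) *\<^sub>R (b + (s o\<^sub>L s))"
    unfolding YS
    by (intro tendsto_intros bounded_bilinear.tendsto[OF bounded_bilinear_blinfun_compose] Ys)
  then have s_eq: "s = (1/2) *\<^sub>R (b + (s o\<^sub>L s))" using LIMSEQ_Suc[OF Ys] LIMSEQ_unique by blast
  have adjY: "adj_pair (blinfun_apply (Y n)) (blinfun_apply (Y n))" for n
  proof (induction n)
    case 0 show ?case by (simp add: Y0 adj_pair_def bounded_clinear_def zero_blinfun.rep_eq)
  next
    case (Suc n)
    show ?case
      unfolding adj_pair_def bounded_clinear_def
      by (auto simp: YS blinfun.bilinear_simps b blB bounded_clinearD(2)[OF adj_pairD(1)[OF Suc]]
          adj_pairD(3)[OF Suc] adj_pairD(3)[OF B] cinner_scaleC_left cinner_scaleC_right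
          cinner_add_left cinner_add_right scaleC_add_right scaleR_scaleC mult.commute
          blinfun.bounded_linear_right)
  qed
  have Yx: "(\<lambda>n. Y n x) \<longlonglongrightarrow> s x" for x
    by (intro tendsto_intros Ys)
  \<comment> \<open>The operator limit is a priori only real-linear; complex linearity of the
    iterates passes to it through inner products.\<close>
  have clin: "s (c *\<^sub>C x) = c *\<^sub>C s x" for c x
  proof (rule cinner_eqI)
    fix z
    have "(\<lambda>n. cinner z (Y n (c *\<^sub>C x))) \<longlonglongrightarrow> cinner z (s (c *\<^sub>C x))"
      by (intro bounded_linear.tendsto[OF bounded_linear_cinner_right] Yx)
    moreover have "(\<lambda>n. cinner z (Y n (c *\<^sub>C x))) \<longlonglongrightarrow> c * cinner z (s x)"
      unfolding bounded_clinearD(2)[OF adj_pairD(1)[OF adjY]] cinner_scaleC_right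
      by (intro tendsto_mult_left bounded_linear.tendsto[OF bounded_linear_cinner_right] Yx)
    ultimately show "cinner z (s (c *\<^sub>C x)) = cinner z (c *\<^sub>C s x)"
      unfolding cinner_scaleC_right by (rule LIMSEQ_unique)
  qed
  have adjs: "cinner (s x) y = cinner x (s y)" for x y
  proof -
    have "(\<lambda>n. cinner x (Y n y)) \<longlonglongrightarrow> cinner x (s y)"
      by (intro bounded_linear.tendsto[OF bounded_linear_cinner_right] Yx)
    moreover have "(\<lambda>n. cinner x (Y n y)) \<longlonglongrightarrow> cinner (s x) y"
      unfolding adj_pairD(3)[OF adjY, symmetric]
      by (intro bounded_linear.tendsto[OF bounded_linear_cinner_left] Yx)
    ultimately show ?thesis by (rule LIMSEQ_unique[symmetric])
  qed
  have "adj_pair (blinfun_apply s) (blinfun_apply s)"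
    by (auto simp: adj_pair_def bounded_clinear_def clin adjs blinfun.bounded_linear_right)
  then have "adj_pair (\<lambda>x. x - s x) (\<lambda>x. x - s x)" by (intro adj_pair_diff adj_pair_id)
  moreover have "(x - s x) - s (x - s x) = x - B x" for x
  proof -
    have "2 *\<^sub>R s x = B x + s (s x)"
      by (subst s_eq) (simp add: blinfun.bilinear_simps b)
    then show ?thesis by (simp add: blinfun.bilinear_simps scaleR_2 algebra_simps)
  qed
  ultimately show thesis by (rule that)
qed

section \<open>Orthonormal bases and Hilbert--Schmidt operators\<close>

definition orthonormal :: "'a::complex_inner set \<Rightarrow> bool" where
  "orthonormal F \<longleftrightarrow> (\<forall>x\<in>F. \<forall>y\<in>F. cinner x y = (if x = y then 1 else 0))"

text \<open>This is the orthogonal projection onto the span of \<open>F\<close> when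
  \<open>F\<close> is finite and orthonormal.\<close>

definition proj_on :: "'a::complex_inner set \<Rightarrow> 'a \<Rightarrow> 'a" where
  "proj_on F x = (\<Sum>e\<in>F. cinner e x *\<^sub>C e)"

lemma orthonormal_subset: "orthonormal E \<Longrightarrow> F \<subseteq> E \<Longrightarrow> orthonormal F"
  unfolding orthonormal_def by blast

lemma orthonormal_norm: "orthonormal F \<Longrightarrow> f \<in> F \<Longrightarrow> norm f = 1"
  using cinner_self[of f]
  by (metis orthonormal_def norm_ge_zero of_real_eq_1_iff power2_eq_1_iff zero_le_one
      neg_0_le_iff_le not_one_le_zero)

lemma cinner_orthonormal_sum:
  assumes "orthonormal F" "finite F" "f \<in> F"
  shows "cinner f (\<Sum>e\<in>F. c e *\<^sub>C e) = c f"
proof -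
  have "cinner f (\<Sum>e\<in>F. c e *\<^sub>C e) = (\<Sum>e\<in>F. if f = e then c e else 0)"
    unfolding cinner_sum_right cinner_scaleC_right
    using assms by (intro sum.cong) (auto simp: orthonormal_def)
  then show ?thesis using assms by simp
qed

lemma cinner_proj_on:
  "orthonormal F \<Longrightarrow> finite F \<Longrightarrow> f \<in> F \<Longrightarrow> cinner f (proj_on F x) = cinner f x"
  by (simp add: proj_on_def cinner_orthonormal_sum)

lemma norm_proj_on_sq:
  assumes "orthonormal F" "finite F"
  shows "of_real ((norm (proj_on F x))\<^sup>2) = cinner x (proj_on F x)"
    and "(norm (proj_on F x))\<^sup>2 = (\<Sum>e\<in>F. (cmod (cinner e x))\<^sup>2)"
proof -
  have eq: "cinner (proj_on F x) z = (\<Sum>e\<in>F. cnj (cinner e x) * cinner e z)" for z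
    by (simp add: proj_on_def cinner_sum_left cinner_scaleC_left)
  have 1: "cinner (proj_on F x) (proj_on F x) = cinner (proj_on F x) x"
    unfolding eq by (intro sum.cong) (auto simp: cinner_proj_on assms)
  show "of_real ((norm (proj_on F x))\<^sup>2) = cinner x (proj_on F x)"
    using 1 cinner_commute[of "proj_on F x" x] by (metis cinner_commute cinner_self)
  have "of_real ((norm (proj_on F x))\<^sup>2) = (\<Sum>e\<in>F. cnj (cinner e x) * cinner e x)"
    using 1 unfolding cinner_self eq .
  also have "\<dots> = of_real (\<Sum>e\<in>F. (cmod (cinner e x))\<^sup>2)"
    by (simp add: complex_norm_square mult.commute del: of_real_power)
  finally show "(norm (proj_on F x))\<^sup>2 = (\<Sum>e\<in>F. (cmod (cinner e x))\<^sup>2)"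
    unfolding of_real_eq_iff .
qed

lemma norm_minus_proj_on_sq:
  assumes "orthonormal F" "finite F"
  shows "(norm (x - proj_on F x))\<^sup>2 = (norm x)\<^sup>2 - (norm (proj_on F x))\<^sup>2"
  using norm_proj_on_sq(1)[OF assms, of x, symmetric]
  by (simp add: norm_diff_sq del: of_real_power)

lemma bessel:
  assumes "orthonormal F" "finite F"
  shows "(\<Sum>e\<in>F. (cmod (cinner e x))\<^sup>2) \<le> (norm x)\<^sup>2"
  using norm_minus_proj_on_sq[OF assms, of x] norm_proj_on_sq(2)[OF assms, of x]
  by (metis diff_ge_0_iff_ge zero_le_power2)

lemma norm_minus_proj_on_le:
  assumes "orthonormal F" "finite F"
  shows "norm (x - proj_on F x) \<le> norm x"
  using norm_minus_proj_on_sq[OF assms, of x] by (simp add: power2_le_imp_le)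

lemma proj_on_diff: "proj_on F (x - y) = proj_on F x - proj_on F (y::'a::complex_inner)"
  by (simp add: proj_on_def cinner_diff_right complex_vector.scale_left_diff_distrib
      sum_subtractf)

lemma proj_on_span:
  assumes "orthonormal F" "finite F" "y \<in> complex_vector.span F"
  shows "proj_on F y = y"
proof -
  obtain c where y: "y = (\<Sum>e\<in>F. c e *\<^sub>C e)"
    using assms(3) unfolding complex_vector.span_finite[OF assms(2)] by auto
  have "cinner e y = c e" if "e \<in> F" for e
    unfolding y by (rule cinner_orthonormal_sum[OF assms(1,2) that])
  then have "proj_on F y = (\<Sum>e\<in>F. c e *\<^sub>C e)"
    unfolding proj_on_def by (intro sum.cong) auto
  then show ?thesis using y by simp
qed

section \<open>Expansions in orthonormal bases and Parseval's identity\<close>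

lemma is_onb_orthonormal: "is_onb E \<Longrightarrow> orthonormal E"
  by (simp add: is_onb_def orthonormal_def)

text \<open>Let \<open>y\<close> in the span approximate \<open>x\<close>. As soon as
  \<open>F\<close> contains the finite support of \<open>y\<close>, the projection fixes
  \<open>y\<close>, so the error at \<open>x\<close> equals the error at \<open>x - y\<close> and is
  at most \<open>norm (x - y)\<close>.\<close>

lemma onb_expansion:
  fixes E :: "'a::complex_inner set"
  assumes E: "is_onb E"
  shows "((\<lambda>e. cinner e x *\<^sub>C e) has_sum x) E"
  unfolding has_sum_def
proof (rule tendstoI)
  fix r :: real assume "r > 0"
  have "x \<in> closure (complex_vector.span E)" using E by (simp add: is_onb_def)
  then obtain y where y: "y \<in> complex_vector.span E" "dist y x < r"
    using \<open>r > 0\<close> by (auto simp: closure_approachable)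
  obtain G where G: "finite G" "G \<subseteq> E" "y \<in> complex_vector.span G"
  proof -
    obtain G c where "finite G" "G \<subseteq> E" "y = (\<Sum>e\<in>G. c e *\<^sub>C e)"
      using y(1) unfolding complex_vector.span_explicit by blast
    moreover from this have "y \<in> complex_vector.span G"
      by (simp add: complex_vector.span_sum complex_vector.span_scale complex_vector.span_base)
    ultimately show thesis using that by blast
  qed
  have "dist (\<Sum>e\<in>F. cinner e x *\<^sub>C e) x < r" if F: "finite F" "G \<subseteq> F" "F \<subseteq> E" for F
  proof -
    have o: "orthonormal F" using is_onb_orthonormal[OF E] F orthonormal_subset by blast
    have "y \<in> complex_vector.span F" using G F complex_vector.span_mono by blast
    then have eq: "x - proj_on F x = (x - y) - proj_on F (x - y)"
      using proj_on_span[OF o F(1)] by (simp add: proj_on_diff)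
    have "norm (x - proj_on F x) \<le> norm (x - y)"
      by (subst eq) (rule norm_minus_proj_on_le[OF o F(1)])
    then show ?thesis using y(2) by (simp add: dist_norm proj_on_def norm_minus_commute)
  qed
  then show "\<forall>\<^sub>F F in finite_subsets_at_top E. dist (\<Sum>e\<in>F. cinner e x *\<^sub>C e) x < r"
    unfolding eventually_finite_subsets_at_top using G by blast
qed

lemma onb_parseval:
  assumes "is_onb E"
  shows "((\<lambda>e. cinner x e * cinner e y) has_sum cinner x y) E"
  using has_sum_bounded_linear[OF bounded_linear_cinner_right onb_expansion[OF assms, of y], of x]
  by (simp add: cinner_scaleC_right mult.commute)

lemma onb_parseval_norm:
  assumes "is_onb E"
  shows "((\<lambda>e. (cmod (cinner e x))\<^sup>2) has_sum (norm x)\<^sup>2) E"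
proof -
  have "cinner x e * cinner e x = of_real ((cmod (cinner e x))\<^sup>2)" for e
    using cinner_commute[of x e] by (simp add: complex_norm_square mult.commute del: of_real_power)
  then have "((\<lambda>e. of_real ((cmod (cinner e x))\<^sup>2)) has_sum (of_real ((norm x)\<^sup>2) :: complex)) E"
    using onb_parseval[OF assms, of x x] by (simp add: cinner_self del: of_real_power)
  from has_sum_bounded_linear[OF bounded_linear_Re this] show ?thesis by (simp del: of_real_power)
qed

section \<open>Hilbert--Schmidt operators and cyclicity of the trace\<close>

definition hilbert_schmidt :: "'a set \<Rightarrow> ('a::complex_inner \<Rightarrow> 'a) \<Rightarrow> bool" where
  "hilbert_schmidt E A \<longleftrightarrow> (\<lambda>e. (norm (A e))\<^sup>2) summable_on E"

lemma hilbert_schmidt_double: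
  assumes "is_onb F" "hilbert_schmidt E A"
  shows "(\<lambda>(e,f). (cmod (cinner f (A e)))\<^sup>2) summable_on (E \<times> F)"
  using assms unfolding hilbert_schmidt_def
  by (intro summable_on_SigmaI[where g = "\<lambda>e. (norm (A e))\<^sup>2"]) (auto intro: onb_parseval_norm)

text \<open>The squared matrix coefficients form one nonnegative double series, which can be summed
  in either order. For self-adjoint \<open>A\<close> this also changes the basis from
  \<open>E\<close> to \<open>F\<close>.\<close>

lemma hilbert_schmidt_adjoint:
  assumes "adj_pair A B" "is_onb E" "is_onb F" "hilbert_schmidt E A"
  shows "hilbert_schmidt F B"
proof -
  have "(\<lambda>(f,e). (cmod (cinner f (A e)))\<^sup>2) summable_on (F \<times> E)"
    using hilbert_schmidt_double[OF assms(3,4)] by (subst summable_on_swap) simp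
  moreover have hs: "((\<lambda>e. (cmod (cinner f (A e)))\<^sup>2) has_sum (norm (B f))\<^sup>2) E" for f
    using onb_parseval_norm[OF assms(2), of "B f"]
    by (simp add: adj_pairD(3)[OF assms(1), symmetric] cmod_cinner_commute)
  ultimately have "(\<lambda>f. \<Sum>\<^sub>\<infinity>e\<in>E. (cmod (cinner f (A e)))\<^sup>2) summable_on F"
    using summable_on_SigmaD[of "\<lambda>(f,e). (cmod (cinner f (A e)))\<^sup>2" F "\<lambda>_. E"]
    by (auto simp: summable_on_def)
  then show ?thesis by (simp add: hilbert_schmidt_def infsumI[OF hs])
qed

lemma hilbert_schmidt_comp_left:
  assumes "bounded_clinear B" "hilbert_schmidt E A"
  shows "hilbert_schmidt E (\<lambda>x. B (A x))"
proof -
  have "(norm (B (A e)))\<^sup>2 \<le> (onorm B)\<^sup>2 * (norm (A e))\<^sup>2" for e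
    using power_mono[OF onorm[OF bounded_clinearD(1)[OF assms(1)], of "A e"] norm_ge_zero, of 2]
    by (simp add: power_mult_distrib)
  then show ?thesis
    using summable_on_comparison_test[OF summable_on_cmult_right
        [OF assms(2)[unfolded hilbert_schmidt_def], of "(onorm B)\<^sup>2"],
        of "\<lambda>e. (norm (B (A e)))\<^sup>2"]
    by (simp add: hilbert_schmidt_def)
qed

text \<open>Passing to adjoints turns right multiplication into left multiplication and
  back.\<close>

lemma hilbert_schmidt_comp_right:
  assumes "is_onb E" "adj_pair A A'" "adj_pair B B'" "hilbert_schmidt E A"
  shows "hilbert_schmidt E (\<lambda>x. A (B x))"
proof (rule hilbert_schmidt_adjoint[OF _ assms(1) assms(1)])
  show "adj_pair (\<lambda>x. B' (A' x)) (\<lambda>x. A (B x))"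
    by (rule adj_pair_comp[OF adj_pair_sym[OF assms(3)] adj_pair_sym[OF assms(2)]])
  show "hilbert_schmidt E (\<lambda>x. B' (A' x))"
    by (rule hilbert_schmidt_comp_left[OF adj_pairD(2)[OF assms(3)]
        hilbert_schmidt_adjoint[OF assms(2,1,1,4)]])
qed

text \<open>Both traces are iterated sums of the products of matrix coefficients \<open>g\<close>,
  which are absolutely summable because a product is dominated by the sum of the squares.\<close>

lemma hilbert_schmidt_trace:
  assumes E: "is_onb E" and A: "adj_pair A A'" and B: "adj_pair B B'"
    and hsA: "hilbert_schmidt E A" and hsB: "hilbert_schmidt E B"
  shows "(\<lambda>e. cinner e (A (B e))) summable_on E" (is ?sum)
    and "(\<Sum>\<^sub>\<infinity>e\<in>E. cinner e (A (B e))) = (\<Sum>\<^sub>\<infinity>e\<in>E. cinner e (B (A e)))" (is ?comm)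
proof -
  define g where "g = (\<lambda>(e,f). cinner e (A f) * cinner f (B e))"
  have "(\<lambda>(e,f). (cmod (cinner f (B e)))\<^sup>2) summable_on (E \<times> E)"
    by (rule hilbert_schmidt_double[OF E hsB])
  moreover have "(\<lambda>(e,f). (cmod (cinner e (A f)))\<^sup>2) summable_on (E \<times> E)"
    using hilbert_schmidt_double[OF E hsA] by (subst summable_on_swap) simp
  ultimately have "(\<lambda>p. (\<lambda>(e,f). (cmod (cinner f (B e)))\<^sup>2) p
      + (\<lambda>(e,f). (cmod (cinner e (A f)))\<^sup>2) p) summable_on (E \<times> E)"
    by (rule summable_on_add)
  then have "(\<lambda>p. norm (g p)) summable_on (E \<times> E)"
  proof (rule Infinite_Sum.abs_summable_on_comparison_test')
    fix p assume "p \<in> E \<times> E"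
    have "a * b \<le> b\<^sup>2 + a\<^sup>2" for a b :: real
      using sum_squares_bound[of a b] zero_le_power2[of a] zero_le_power2[of b] by argo
    then show "norm (g p) \<le> (\<lambda>(e,f). (cmod (cinner f (B e)))\<^sup>2) p
      + (\<lambda>(e,f). (cmod (cinner e (A f)))\<^sup>2) p"
      by (cases p) (simp add: g_def norm_mult)
  qed
  then obtain S where S: "(g has_sum S) (E \<times> E)"
    using abs_summable_summable summable_on_def by blast
  have 1: "((\<lambda>e. cinner e (A (B e))) has_sum S) E"
  proof (rule has_sum_SigmaD[OF S])
    fix e
    show "((\<lambda>f. g (e, f)) has_sum cinner e (A (B e))) E"
      using onb_parseval[OF E, of "A' e" "B e"] by (simp add: g_def adj_pairD(3)[OF A])
  qed
  have 2: "((\<lambda>f. cinner f (B (A f))) has_sum S) E"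
  proof (rule has_sum_SigmaD)
    show "((\<lambda>(f,e). g (e, f)) has_sum S) (E \<times> E)" using S has_sum_swap by blast
    fix f
    show "((\<lambda>e. (\<lambda>(f,e). g (e, f)) (f, e)) has_sum cinner f (B (A f))) E"
      using onb_parseval[OF E, of "B' f" "A f"]
      by (simp add: g_def adj_pairD(3)[OF B] mult.commute)
  qed
  show ?sum using 1 summable_on_def by blast
  show ?comm using 1 2 by (simp add: infsumI)
qed

text \<open>Parseval along \<open>E\<close> expands each \<open>norm (B f)\<close>, and Bessel's
  inequality for \<open>F\<close> bounds the sum at each \<open>A e\<close>. It serves to bound the
  dimension of the kernel.\<close>

lemma hilbert_schmidt_orthonormal_bound:
  assumes E: "is_onb E" and A: "adj_pair A B" and hs: "hilbert_schmidt E A"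
    and F: "orthonormal F" "finite F"
  shows "(\<Sum>f\<in>F. (norm (B f))\<^sup>2) \<le> (\<Sum>\<^sub>\<infinity>e\<in>E. (norm (A e))\<^sup>2)"
proof -
  have "((\<lambda>e. \<Sum>f\<in>F. (cmod (cinner f (A e)))\<^sup>2) has_sum (\<Sum>f\<in>F. (norm (B f))\<^sup>2)) E"
    using F(2)
  proof (induction F)
    case (insert f F)
    have "((\<lambda>e. (cmod (cinner f (A e)))\<^sup>2) has_sum (norm (B f))\<^sup>2) E"
      using onb_parseval_norm[OF E, of "B f"]
      by (simp add: adj_pairD(3)[OF A, symmetric] cmod_cinner_commute)
    then show ?case using insert by (simp add: has_sum_add)
  qed simp
  moreover have "((\<lambda>e. (norm (A e))\<^sup>2) has_sum (\<Sum>\<^sub>\<infinity>e\<in>E. (norm (A e))\<^sup>2)) E"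
    using hs by (simp add: hilbert_schmidt_def)
  ultimately show ?thesis by (rule has_sum_mono) (rule bessel[OF F])
qed

section \<open>Compactness of Hilbert--Schmidt operators\<close>

lemma summable_on_small_tail:
  fixes f :: "'b \<Rightarrow> real"
  assumes "f summable_on E" "\<And>e. e \<in> E \<Longrightarrow> f e \<ge> 0" "r > 0"
  obtains F where "finite F" "F \<subseteq> E" "\<And>G. finite G \<Longrightarrow> G \<subseteq> E - F \<Longrightarrow> sum f G < r"
proof -
  have s: "(f has_sum infsum f E) E" using assms(1) by simp
  have "\<forall>\<^sub>F F in finite_subsets_at_top E. sum f F > infsum f E - r"
    using s assms(3) unfolding has_sum_def by (intro order_tendstoD) auto
  then obtain F where F: "finite F" "F \<subseteq> E" "sum f F > infsum f E - r"
    unfolding eventually_finite_subsets_at_top by blast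
  show thesis
  proof (rule that[OF F(1,2)])
    fix G assume G: "finite G" "G \<subseteq> E - F"
    have "sum f (F \<union> G) \<le> infsum f E"
      using F G assms(2) by (intro finite_sum_le_has_sum[OF s]) auto
    moreover have "sum f (F \<union> G) = sum f F + sum f G"
      using F G by (intro sum.union_disjoint) auto
    ultimately show "sum f G < r" using F(3) by linarith
  qed
qed

lemma compact_finite_combinations:
  fixes v :: "'b \<Rightarrow> 'a::complex_inner"
  assumes "finite F"
  shows "\<exists>K. compact K \<and> (\<forall>c. (\<forall>e\<in>F. cmod (c e) \<le> 1) \<longrightarrow> (\<Sum>e\<in>F. c e *\<^sub>C v e) \<in> K)"
  using assms
proof (induction F)
  case empty show ?case by (intro exI[of _ "{0}"]) simp
next
  case (insert f F)
  then obtain K where K: "compact K" "\<And>c. (\<forall>e\<in>F. cmod (c e) \<le> 1) \<Longrightarrow> (\<Sum>e\<in>F. c e *\<^sub>C v e) \<in> K"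
    by blast
  have "bounded_linear (\<lambda>c. c *\<^sub>C v f)"
    by (rule bounded_linear_intro[of _ "norm (v f)"])
       (auto simp: scaleC_add_left scaleR_scaleC[where x = "c *\<^sub>C v f" for c] scaleC_scaleC scaleR_conv_of_real)
  then have "compact ((\<lambda>c. c *\<^sub>C v f) ` cball 0 1)"
    by (intro compact_continuous_image linear_continuous_on) auto
  then have "compact {x + y |x y. x \<in> (\<lambda>c. c *\<^sub>C v f) ` cball 0 1 \<and> y \<in> K}"
    using K(1) by (rule compact_sums)
  moreover have "(\<Sum>e\<in>insert f F. c e *\<^sub>C v e)
      \<in> {x + y |x y. x \<in> (\<lambda>c. c *\<^sub>C v f) ` cball 0 1 \<and> y \<in> K}"
    if "\<forall>e\<in>insert f F. cmod (c e) \<le> 1" for c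
  proof -
    have "c f *\<^sub>C v f \<in> (\<lambda>c. c *\<^sub>C v f) ` cball 0 1" using that by (intro imageI) simp
    moreover have "(\<Sum>e\<in>F. c e *\<^sub>C v e) \<in> K" using that by (intro K(2)) simp
    ultimately show ?thesis using insert(1,2) by auto
  qed
  ultimately show ?case by blast
qed

text \<open>Cauchy-Schwarz on finite partial sums of the expansion of \<open>A z\<close>: the
  coefficients are controlled by Bessel, the images by the tail assumption, and the terms from
  \<open>F\<close> vanish.\<close>

lemma hilbert_schmidt_tail_bound:
  assumes E: "is_onb E" and A: "bounded_clinear A"
    and F: "\<And>G. finite G \<Longrightarrow> G \<subseteq> E - F \<Longrightarrow> (\<Sum>e\<in>G. (norm (A e))\<^sup>2) < r\<^sup>2"
    and z: "\<And>e. e \<in> F \<Longrightarrow> cinner e z = 0" and "r > 0"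
  shows "norm (A z) \<le> norm z * r"
proof -
  have "((\<lambda>e. A (cinner e z *\<^sub>C e)) has_sum A z) E"
    by (rule has_sum_bounded_linear[OF bounded_clinearD(1)[OF A] onb_expansion[OF E]])
  then have "((\<lambda>G. norm (\<Sum>e\<in>G. cinner e z *\<^sub>C A e)) \<longlongrightarrow> norm (A z)) (finite_subsets_at_top E)"
    unfolding has_sum_def by (intro tendsto_norm) (simp add: bounded_clinearD[OF A])
  moreover have "\<forall>\<^sub>F G in finite_subsets_at_top E.
      norm (\<Sum>e\<in>G. cinner e z *\<^sub>C A e) \<le> norm z * r"
  proof (rule eventually_finite_subsets_at_top_weakI)
    fix G assume G: "finite G" "G \<subseteq> E"
    have o: "orthonormal (G - F)"
      using is_onb_orthonormal[OF E] G orthonormal_subset by blast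
    have "(\<Sum>e\<in>G. cinner e z *\<^sub>C A e) = (\<Sum>e\<in>G - F. cinner e z *\<^sub>C A e)"
      using G z by (intro sum.mono_neutral_right) auto
    also have "norm \<dots> \<le> (\<Sum>e\<in>G - F. \<bar>cmod (cinner e z)\<bar> * \<bar>norm (A e)\<bar>)"
      by (rule order_trans[OF norm_sum]) simp
    also have "\<dots> \<le> L2_set (\<lambda>e. cmod (cinner e z)) (G - F) * L2_set (\<lambda>e. norm (A e)) (G - F)"
      by (rule L2_set_mult_ineq)
    also have "\<dots> \<le> norm z * r"
    proof (intro mult_mono)
      show "L2_set (\<lambda>e. cmod (cinner e z)) (G - F) \<le> norm z"
        using bessel[OF o, of z] G by (simp add: L2_set_def real_le_lsqrt)
      show "L2_set (\<lambda>e. norm (A e)) (G - F) \<le> r"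
        using F[of "G - F"] G Diff_mono[of G E F F] \<open>r > 0\<close>
        by (auto simp: L2_set_def intro!: real_le_lsqrt)
    qed (auto simp: L2_set_def intro!: sum_nonneg)
    finally show "norm (\<Sum>e\<in>G. cinner e z *\<^sub>C A e) \<le> norm z * r" .
  qed
  ultimately show ?thesis by (rule tendsto_upperbound) simp
qed

text \<open>Up to a small tail, \<open>A\<close> acts through finitely many basis vectors, whose
  bounded combinations lie in a compact set; hence the image of the ball is totally bounded.\<close>

lemma hilbert_schmidt_compact:
  fixes A :: "'a::chilbert_space \<Rightarrow> 'a"
  assumes E: "is_onb E" and A: "bounded_clinear A" and hs: "hilbert_schmidt E A"
  shows "compact (closure (A ` cball 0 1))"
  unfolding compact_eq_totally_bounded
proof (intro conjI allI impI)
  show "complete (closure (A ` cball 0 1))" by (simp add: complete_eq_closed)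
  fix r :: real assume "r > 0"
  then have "(r / 4)\<^sup>2 > 0" by simp
  then obtain F where F: "finite F" "F \<subseteq> E"
    and tail: "\<And>G. finite G \<Longrightarrow> G \<subseteq> E - F \<Longrightarrow> (\<Sum>e\<in>G. (norm (A e))\<^sup>2) < (r / 4)\<^sup>2"
    using summable_on_small_tail[OF hs[unfolded hilbert_schmidt_def]] by (metis zero_le_power2)
  have o: "orthonormal F" using is_onb_orthonormal[OF E] F orthonormal_subset by blast
  obtain K where K: "compact K"
    "\<And>c. (\<forall>e\<in>F. cmod (c e) \<le> 1) \<Longrightarrow> (\<Sum>e\<in>F. c e *\<^sub>C A e) \<in> K"
    using compact_finite_combinations[OF F(1), of A] by blast
  obtain k where k: "finite k" "K \<subseteq> (\<Union>x\<in>k. ball x (r / 4))"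
    using K(1) \<open>r > 0\<close> unfolding compact_eq_totally_bounded by (metis divide_pos_pos zero_less_numeral)
  \<comment> \<open>One quarter of \<open>r\<close> pays for the net and one quarter for the tail.
    The balls are closed so that the covering survives the closure.\<close>
  have "A ` cball 0 1 \<subseteq> (\<Union>x\<in>k. cball x (r / 2))"
  proof safe
    fix x :: 'a assume "x \<in> cball 0 1"
    then have x: "norm x \<le> 1" by simp
    have "cmod (cinner e x) \<le> 1" if "e \<in> F" for e
      using cmod_cinner_le[of e x] orthonormal_norm[OF o that] x by simp
    then have "(\<Sum>e\<in>F. cinner e x *\<^sub>C A e) \<in> K" by (intro K(2)) auto
    then have "A (proj_on F x) \<in> K" by (simp add: proj_on_def bounded_clinearD[OF A])
    then obtain y where y: "y \<in> k" "dist y (A (proj_on F x)) < r / 4" using k(2) by auto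
    have "norm (A (x - proj_on F x)) \<le> norm (x - proj_on F x) * (r / 4)"
      using \<open>r > 0\<close>
      by (intro hilbert_schmidt_tail_bound[OF E A tail])
         (auto simp: cinner_diff_right cinner_proj_on[OF o F(1)])
    also have "\<dots> \<le> 1 * (r / 4)"
      using norm_minus_proj_on_le[OF o F(1), of x] x \<open>r > 0\<close> by (intro mult_right_mono) auto
    finally have "dist (A (proj_on F x)) (A x) \<le> r / 4"
      by (simp add: bounded_clinearD[OF A] dist_norm norm_minus_commute)
    then have "dist y (A x) \<le> r / 2"
      using y(2) dist_triangle[of y "A x" "A (proj_on F x)"] by linarith
    then show "A x \<in> (\<Union>x\<in>k. cball x (r / 2))" using y(1) by auto
  qed
  then have "closure (A ` cball 0 1) \<subseteq> (\<Union>x\<in>k. cball x (r / 2))"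
    by (intro closure_minimal closed_UN k(1)) auto
  also have "\<dots> \<subseteq> (\<Union>x\<in>k. ball x r)" using \<open>r > 0\<close> by (force simp: subset_iff)
  finally show "\<exists>k. finite k \<and> closure (A ` cball 0 1) \<subseteq> (\<Union>x\<in>k. ball x r)" using k(1) by blast
qed

section \<open>Spectral gap, kernel and range\<close>

lemma adj_pair_norm_le:
  assumes T: "adj_pair T T'" and "\<And>x. norm (T x) \<le> norm x"
  shows "norm (T' x) \<le> norm x"
proof (cases "T' x = 0")
  case False
  have "norm (T' x) * norm (T' x) = inner x (T (T' x))"
    by (simp add: adj_pair_inner[OF T, symmetric] flip: power2_norm_eq_inner power2_eq_square)
  also have "\<dots> \<le> norm x * norm (T (T' x))" by (rule norm_cauchy_schwarz)
  also have "\<dots> \<le> norm x * norm (T' x)" by (intro mult_left_mono assms(2)) auto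
  finally show ?thesis using False by simp
qed simp

lemma adj_pair_ker:
  assumes "adj_pair T T'" "T' (T x) = 0"
  shows "T x = 0"
  using adj_pairD(4)[OF assms(1), of x "T x"] assms(2) by simp

text \<open>If no \<open>q\<close> works, unit vectors orthogonal to the kernel have images under
  \<open>D\<close> with norms tending to 1. By compactness a subsequence converges to a unit vector
  fixed by \<open>D\<close>, hence in the kernel and orthogonal to itself.\<close>

lemma spectral_gap:
  fixes T :: "'a::chilbert_space \<Rightarrow> 'a"
  assumes E: "is_onb E" and T: "adj_pair T T'" and T1: "\<And>x. norm (T x) \<le> norm x"
    and D: "\<And>x. D x = x - T' (T x)" and hs: "hilbert_schmidt E D"
  obtains q where "0 \<le> q" "q < 1"
    "\<And>x. (\<And>k. T k = 0 \<Longrightarrow> cinner k x = 0) \<Longrightarrow> norm (D x) \<le> q * norm x"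
proof (rule ccontr)
  assume contra: "\<not> thesis"
  have D_eq: "D = (\<lambda>x. x - T' (T x))" by (rule ext) (rule D)
  have aD: "adj_pair D D"
    unfolding D_eq by (rule adj_pair_diff[OF adj_pair_id adj_pair_comp[OF adj_pair_sym[OF T] T]])
  note blD = bounded_clinearD[OF adj_pairD(1)[OF aD]]
  note T'1 = adj_pair_norm_le[OF T T1]
  have "\<exists>x. norm x = 1 \<and> (\<forall>k. T k = 0 \<longrightarrow> cinner k x = 0) \<and> norm (D x) > 1 - 1 / real (Suc n)"
    for n
  proof -
    have "\<not> (\<forall>x. (\<forall>k. T k = 0 \<longrightarrow> cinner k x = 0) \<longrightarrow> norm (D x) \<le> (1 - 1 / real (Suc n)) * norm x)"
      using that[of "1 - 1 / real (Suc n)"] contra by auto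
    then obtain x where x: "\<And>k. T k = 0 \<Longrightarrow> cinner k x = 0"
      "norm (D x) > (1 - 1 / real (Suc n)) * norm x" by (auto simp: not_le)
    have "x \<noteq> 0" using x(2) blD(5) by auto
    define u where "u = (1 / norm x) *\<^sub>R x"
    have "norm (D u) = norm (D x) / norm x"
      by (simp add: u_def scaleR_scaleC blD norm_divide)
    then have "norm (D u) > 1 - 1 / real (Suc n)"
      using x(2) \<open>x \<noteq> 0\<close> by (simp add: pos_less_divide_eq)
    moreover have "norm u = 1" using \<open>x \<noteq> 0\<close> by (simp add: u_def)
    moreover have "\<forall>k. T k = 0 \<longrightarrow> cinner k u = 0" by (simp add: u_def cinner_scaleR_right x(1))
    ultimately show ?thesis by blast
  qed
  then obtain s where s: "\<And>n. norm (s n) = 1" "\<And>n k. T k = 0 \<Longrightarrow> cinner k (s n) = 0"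
    "\<And>n. norm (D (s n)) > 1 - 1 / real (Suc n)" by metis
  have "seq_compact (closure (D ` cball 0 1))"
    using hilbert_schmidt_compact[OF E adj_pairD(1)[OF aD] hs] compact_imp_seq_compact by blast
  moreover have "D (s n) \<in> closure (D ` cball 0 1)" for n
    using s(1)[of n] closure_subset by fastforce
  ultimately obtain l r where r: "strict_mono r" and l: "((\<lambda>n. D (s n)) \<circ> r) \<longlonglongrightarrow> l"
    unfolding seq_compact_def by metis
  have lim1: "(\<lambda>n. norm (D (s n))) \<longlonglongrightarrow> 1"
  proof (rule tendsto_sandwich)
    show "\<forall>\<^sub>F n in sequentially. 1 - 1 / real (Suc n) \<le> norm (D (s n))"
      using s(3) by (simp add: less_imp_le)
    have "norm (D x) \<le> norm x" for x
    proof -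
      have "(norm (D x))\<^sup>2 = (norm x)\<^sup>2 - 2 * (norm (T x))\<^sup>2 + (norm (T' (T x)))\<^sup>2"
        unfolding D norm_diff_sq by (simp add: adj_pairD(4)[OF T, symmetric] cinner_self)
      moreover have "(norm (T' (T x)))\<^sup>2 \<le> (norm (T x))\<^sup>2" by (intro power_mono T'1) auto
      ultimately have "(norm (D x))\<^sup>2 \<le> (norm x)\<^sup>2" using zero_le_power2[of "norm (T x)"] by linarith
      then show ?thesis by (rule power2_le_imp_le) simp
    qed
    from this[of "s n" for n] show "\<forall>\<^sub>F n in sequentially. norm (D (s n)) \<le> 1"
      by (simp add: s(1))
    have "(\<lambda>n. 1 - 1 / real (Suc n)) \<longlonglongrightarrow> 1 - 0"
      by (intro tendsto_diff tendsto_const LIMSEQ_Suc lim_const_over_n)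
    then show "(\<lambda>n. 1 - 1 / real (Suc n)) \<longlonglongrightarrow> 1" by simp
  qed simp
  \<comment> \<open>The left side is the square of \<open>norm (T' (T (s n)))\<close>, hence at most
    that of \<open>norm (T (s n))\<close>. Twice this estimate minus the expansion of the left side
    eliminates the inner product.\<close>
  have near: "(norm (s n - D (s n)))\<^sup>2 \<le> 1 - (norm (D (s n)))\<^sup>2" for n
  proof -
    have "(norm (s n - D (s n)))\<^sup>2 = 1 - 2 * Re (cinner (s n) (D (s n))) + (norm (D (s n)))\<^sup>2"
      by (simp add: norm_diff_sq s(1))
    moreover have "(norm (s n - D (s n)))\<^sup>2 \<le> (norm (T (s n)))\<^sup>2"
      unfolding D using T'1 by (simp add: power_mono)
    moreover have "(norm (T (s n)))\<^sup>2 = 1 - Re (cinner (s n) (D (s n)))"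
      unfolding D cinner_diff_right adj_pairD(4)[OF T, symmetric] by (simp add: cinner_self s(1))
    ultimately show ?thesis by linarith
  qed
  have "(\<lambda>n. (norm (s n - D (s n)))\<^sup>2) \<longlonglongrightarrow> 0"
  proof (rule tendsto_sandwich[OF _ _ tendsto_const])
    have "(\<lambda>n. 1 - (norm (D (s n)))\<^sup>2) \<longlonglongrightarrow> 1 - 1\<^sup>2" by (intro tendsto_intros lim1)
    then show "(\<lambda>n. 1 - (norm (D (s n)))\<^sup>2) \<longlonglongrightarrow> 0" by simp
  qed (use near in simp_all)
  then have "(\<lambda>n. sqrt ((norm (s n - D (s n)))\<^sup>2)) \<longlonglongrightarrow> sqrt 0" by (rule tendsto_real_sqrt)
  then have "(\<lambda>n. s n - D (s n)) \<longlonglongrightarrow> 0" by (simp add: tendsto_norm_zero_iff)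
  from LIMSEQ_subseq_LIMSEQ[OF this r]
  have "(\<lambda>n. (s (r n) - D (s (r n))) + D (s (r n))) \<longlonglongrightarrow> 0 + l"
    using l by (intro tendsto_add) (simp_all add: o_def)
  then have sr: "(\<lambda>n. s (r n)) \<longlonglongrightarrow> l" by simp
  then have "(\<lambda>n. D (s (r n))) \<longlonglongrightarrow> D l" by (rule bounded_linear.tendsto[OF blD(1)])
  then have "D l = l" using l LIMSEQ_unique by (auto simp: o_def)
  then have "T l = 0" by (intro adj_pair_ker[OF T]) (simp add: D)
  then have "cinner l (s (r n)) = 0" for n by (rule s(2))
  moreover have "(\<lambda>n. cinner l (s (r n))) \<longlonglongrightarrow> cinner l l"
    by (intro bounded_linear.tendsto[OF bounded_linear_cinner_right] sr)
  ultimately have "l = 0" by (simp add: LIMSEQ_const_iff)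
  moreover have "(\<lambda>n. norm (s (r n))) \<longlonglongrightarrow> norm l" by (intro tendsto_norm sr)
  ultimately show False by (simp add: s(1) LIMSEQ_const_iff)
qed

text \<open>On the kernel \<open>R\<close> composed with itself is the identity, so each unit vector
  there contributes 1 to the Hilbert--Schmidt sum of \<open>R\<close>. Orthonormal families in the
  kernel are therefore bounded in size, and a largest one spans it.\<close>

lemma kernel_orthonormal_basis:
  fixes T :: "'a::chilbert_space \<Rightarrow> 'a"
  assumes E: "is_onb E" and T: "bounded_clinear T"
    and R: "adj_pair R R" "\<And>x. R (R x) = x - T' (T x)" "hilbert_schmidt E R" and "T' 0 = 0"
  obtains F where "finite F" "orthonormal F" "F \<subseteq> {x. T x = 0}" "\<And>x. T x = 0 \<Longrightarrow> proj_on F x = x"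
proof -
  note blT = bounded_clinearD[OF T]
  define P where "P F \<longleftrightarrow> finite F \<and> orthonormal F \<and> F \<subseteq> {x. T x = 0}" for F
  define b where "b = (\<Sum>\<^sub>\<infinity>e\<in>E. (norm (R e))\<^sup>2)"
  have "card F \<le> nat \<lceil>b\<rceil>" if "P F" for F
  proof -
    have F: "finite F" "orthonormal F" "\<And>x. x \<in> F \<Longrightarrow> T x = 0" using that by (auto simp: P_def)
    have "(norm (R f))\<^sup>2 = 1" if "f \<in> F" for f
    proof -
      have "complex_of_real ((norm (R f))\<^sup>2) = cinner f f"
        using adj_pairD(3)[OF R(1), of f "R f"] F(3)[OF that] \<open>T' 0 = 0\<close>
        by (simp add: R(2) cinner_self)
      also have "\<dots> = of_real 1" using F(2) that by (simp add: orthonormal_def)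
      finally show ?thesis unfolding of_real_eq_iff .
    qed
    then have "real (card F) = (\<Sum>f\<in>F. (norm (R f))\<^sup>2)" by simp
    also have "\<dots> \<le> b"
      unfolding b_def by (rule hilbert_schmidt_orthonormal_bound[OF E R(1,3) F(2,1)])
    finally show ?thesis by linarith
  qed
  moreover have "P {}" by (simp add: P_def orthonormal_def)
  \<comment> \<open>The successor turns the bound on the cardinality into the strict one required
    for the existence of a maximum.\<close>
  ultimately obtain F where F: "P F" and max: "\<And>G. P G \<Longrightarrow> card G \<le> card F"
    using ex_has_greatest_nat[of P "{}" card "Suc (nat \<lceil>b\<rceil>)"] by (metis le_imp_less_Suc)
  have F': "finite F" "orthonormal F" "\<And>x. x \<in> F \<Longrightarrow> T x = 0" using F by (auto simp: P_def)
  have "proj_on F x = x" if x: "T x = 0" for x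
  proof (rule ccontr)
    define z where "z = x - proj_on F x"
    assume "proj_on F x \<noteq> x"
    then have "z \<noteq> 0" by (simp add: z_def)
    \<comment> \<open>The normalized residual of \<open>x\<close> would enlarge the maximal
      family.\<close>
    define u where "u = (1 / norm z) *\<^sub>R z"
    have u1: "cinner u u = 1"
      using \<open>z \<noteq> 0\<close> by (simp add: u_def cinner_self)
    have "T (proj_on F x) = 0" using F'(3) by (simp add: proj_on_def blT)
    then have "T u = 0" using x by (simp add: u_def scaleR_scaleC blT z_def)
    have fu: "cinner f u = 0" if "f \<in> F" for f
      using that by (simp add: u_def z_def cinner_scaleR_right cinner_diff_right
          cinner_proj_on F'(1,2))
    then have uf: "cinner u f = 0" if "f \<in> F" for f
      using cinner_commute[of u f] that by simp
    have "u \<notin> F" using fu[of u] u1 by auto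
    moreover have "P (insert u F)"
      using F' \<open>T u = 0\<close> fu uf u1 \<open>u \<notin> F\<close> by (auto simp: P_def orthonormal_def)
    ultimately show False using max[of "insert u F"] F'(1) by simp
  qed
  then show thesis using that F by (auto simp: P_def)
qed

text \<open>Being self-adjoint and the identity on the kernel, \<open>D\<close> preserves the
  orthogonal complement and contracts it by \<open>q\<close>. The series of all
  \<open>D ^^ n\<close> applied to \<open>y\<close> then solves \<open>T' (T s) = y\<close>, since
  \<open>T' T = I - D\<close>.\<close>

lemma neumann_range_adjoint:
  fixes T :: "'a::chilbert_space \<Rightarrow> 'a"
  assumes T: "adj_pair T T'" and D: "\<And>x. D x = x - T' (T x)"
    and q: "0 \<le> q" "q < 1"
    and gap: "\<And>x. (\<And>k. T k = 0 \<Longrightarrow> cinner k x = 0) \<Longrightarrow> norm (D x) \<le> q * norm x"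
    and y: "\<And>k. T k = 0 \<Longrightarrow> cinner k y = 0"
  shows "norm ((D ^^ n) y) \<le> q ^ n * norm y"
    and "y \<in> range T'"
proof -
  have D_eq: "D = (\<lambda>x. x - T' (T x))" by (rule ext) (rule D)
  have aD: "adj_pair D D"
    unfolding D_eq by (rule adj_pair_diff[OF adj_pair_id adj_pair_comp[OF adj_pair_sym[OF T] T]])
  note blD = bounded_clinearD[OF adj_pairD(1)[OF aD]]
  note blT' = bounded_clinearD[OF adj_pairD(2)[OF T]]
  have orth: "cinner k ((D ^^ n) y) = 0" if "T k = 0" for k n
  proof -
    have "D k = k" using that by (simp add: D blT')
    then have "cinner k ((D ^^ n) y) = cinner k y"
      by (induction n) (simp_all add: adj_pairD(3)[OF aD, symmetric])
    then show ?thesis using y that by simp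
  qed
  have bound: "norm ((D ^^ n) y) \<le> q ^ n * norm y" for n
  proof (induction n)
    case (Suc n)
    have "norm (D ((D ^^ n) y)) \<le> q * norm ((D ^^ n) y)" by (intro gap orth)
    also have "\<dots> \<le> q * (q ^ n * norm y)" by (intro mult_left_mono Suc q)
    finally show ?case by (simp add: mult_ac)
  qed simp
  then show "norm ((D ^^ n) y) \<le> q ^ n * norm y" .
  have "summable (\<lambda>n. q ^ n * norm y)" using q by (intro summable_mult2 summable_geometric) simp
  then have sm: "summable (\<lambda>n. (D ^^ n) y)"
    by (rule summable_comparison_test') (use bound in auto)
  define s where "s = (\<Sum>n. (D ^^ n) y)"
  have "D s = (\<Sum>n. (D ^^ Suc n) y)"
    unfolding s_def bounded_linear.suminf[OF blD(1) sm] by simp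
  also have "\<dots> = s - y"
    unfolding s_def using suminf_split_head[OF sm] by simp
  finally have "T' (T s) = y" by (simp add: D)
  then show "y \<in> range T'" by blast
qed

text \<open>Subtracting the projection onto the kernel leaves a power of \<open>D\<close> on the
  orthogonal complement, where it decays geometrically; the projection itself has trace
  \<open>card F\<close>.\<close>

lemma trace_powers_tendsto:
  fixes T :: "'a::chilbert_space \<Rightarrow> 'a"
  assumes E: "is_onb E" and T: "adj_pair T T'"
    and D: "\<And>x. D x = x - T' (T x)" and hs: "hilbert_schmidt E D"
    and q: "0 \<le> q" "q < 1"
    and gap: "\<And>x. (\<And>k. T k = 0 \<Longrightarrow> cinner k x = 0) \<Longrightarrow> norm (D x) \<le> q * norm x"
    and F: "finite F" "orthonormal F" "F \<subseteq> {x. T x = 0}" "\<And>x. T x = 0 \<Longrightarrow> proj_on F x = x"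
  shows "(\<lambda>n. \<Sum>\<^sub>\<infinity>e\<in>E. cinner e ((D ^^ (n + 2)) e)) \<longlonglongrightarrow> of_nat (card F)"
proof -
  have D_eq: "D = (\<lambda>x. x - T' (T x))" by (rule ext) (rule D)
  have aD: "adj_pair D D"
    unfolding D_eq by (rule adj_pair_diff[OF adj_pair_id adj_pair_comp[OF adj_pair_sym[OF T] T]])
  note blD = bounded_clinearD[OF adj_pairD(1)[OF aD]]
  note blT' = bounded_clinearD[OF adj_pairD(2)[OF T]]
  note blDn = bounded_clinearD[OF adj_pairD(1)[OF adj_pair_funpow[OF aD]]]
  have DF: "D f = f" if "f \<in> F" for f using that F(3) by (auto simp: D blT')
  have DP: "D (proj_on F x) = proj_on F x" for x
    using DF by (simp add: proj_on_def blD)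
  have PD: "proj_on F (D x) = proj_on F x" for x
    using DF by (simp add: proj_on_def adj_pairD(3)[OF aD, symmetric])
  have DnP: "(D ^^ n) (proj_on F x) = proj_on F x" for n x
    by (induction n) (simp_all add: DP)
  have perp: "cinner k (x - proj_on F x) = 0" if "T k = 0" for k x
  proof -
    have "cinner (proj_on F k) (x - proj_on F x) = 0"
      unfolding proj_on_def[of F k]
      by (simp add: cinner_sum_left cinner_scaleC_left cinner_diff_right cinner_proj_on F(1,2))
    then show ?thesis using F(4)[OF that] by simp
  qed
  define c where "c = (\<Sum>\<^sub>\<infinity>e\<in>E. (norm (D e))\<^sup>2)"
  have c: "((\<lambda>e. (norm (D e))\<^sup>2) has_sum c) E"
    using hs by (simp add: c_def hilbert_schmidt_def)
  \<comment> \<open>Of the \<open>n + 2\<close> factors one is moved to each side of the inner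
    product: these give the summable \<open>(norm (D e))\<^sup>2\<close>, while the inner
    \<open>n\<close> give \<open>q ^ n\<close>.\<close>
  define h where "h n e = cinner e ((D ^^ (n + 2)) e) - cinner e (proj_on F e)" for n e
  have h: "cmod (h n e) \<le> q ^ n * (norm (D e))\<^sup>2" for n e
  proof -
    have "h n e = cinner e ((D ^^ (n + 2)) (e - proj_on F e))"
      by (simp only: h_def blDn DnP cinner_diff_right)
    also have "\<dots> = cinner (D e) ((D ^^ n) (D (e - proj_on F e)))"
      by (simp add: adj_pairD(3)[OF aD] funpow_swap1)
    also have "D (e - proj_on F e) = D e - proj_on F (D e)" by (simp add: blD DP PD)
    finally have "cmod (h n e) \<le> norm (D e) * norm ((D ^^ n) (D e - proj_on F (D e)))"
      using cmod_cinner_le by simp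
    also have "\<dots> \<le> norm (D e) * (q ^ n * norm (D e - proj_on F (D e)))"
      by (intro mult_left_mono neumann_range_adjoint(1)[OF T D q gap] perp) auto
    also have "\<dots> \<le> norm (D e) * (q ^ n * norm (D e))"
      using q by (intro mult_left_mono norm_minus_proj_on_le F) auto
    finally show ?thesis by (simp add: power2_eq_square mult_ac)
  qed
  \<comment> \<open>By Parseval each rank-one projection onto a unit vector \<open>f\<close> has
    trace \<open>cinner f f = 1\<close>.\<close>
  have pF: "((\<lambda>e. cinner e (proj_on F e)) has_sum of_nat (card F)) E"
  proof -
    have "((\<lambda>e. \<Sum>f\<in>G. cinner e f * cinner f e) has_sum (\<Sum>f\<in>G. cinner f f)) E"
      if "finite G" for G
      using that
    proof (induction G)
      case (insert f G)
      have "((\<lambda>e. cinner e f * cinner f e) has_sum cinner f f) E"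
        using onb_parseval[OF E, of f f] by (simp add: mult.commute)
      then show ?case using insert by (simp add: has_sum_add)
    qed simp
    from this[OF F(1)] have "((\<lambda>e. cinner e (proj_on F e)) has_sum (\<Sum>f\<in>F. cinner f f)) E"
      by (simp add: proj_on_def cinner_sum_right cinner_scaleC_right mult.commute)
    also have "(\<Sum>f\<in>F. cinner f f) = (\<Sum>f\<in>F. 1)"
      using F(2) by (intro sum.cong) (auto simp: orthonormal_def)
    finally show ?thesis by simp
  qed
  have bnd: "norm ((\<Sum>\<^sub>\<infinity>e\<in>E. cinner e ((D ^^ (n + 2)) e)) - of_nat (card F)) \<le> q ^ n * c" for n
  proof -
    have qc: "((\<lambda>e. q ^ n * (norm (D e))\<^sup>2) has_sum q ^ n * c) E"
      by (rule has_sum_cmult_right[OF c])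
    have "(\<lambda>e. norm (h n e)) summable_on E"
      by (rule Infinite_Sum.abs_summable_on_comparison_test')
         (use qc h in \<open>auto simp: summable_on_def\<close>)
    then have "h n summable_on E" by (rule abs_summable_summable)
    then obtain S where S: "(h n has_sum S) E" by (auto simp: summable_on_def)
    have "((\<lambda>e. h n e + cinner e (proj_on F e)) has_sum (S + of_nat (card F))) E"
      by (rule has_sum_add[OF S pF])
    then have "((\<lambda>e. cinner e ((D ^^ (n + 2)) e)) has_sum (S + of_nat (card F))) E"
      by (simp add: h_def del: funpow.simps)
    then have "(\<Sum>\<^sub>\<infinity>e\<in>E. cinner e ((D ^^ (n + 2)) e)) - of_nat (card F) = S"
      by (simp add: infsumI del: funpow.simps)
    moreover have "norm S \<le> q ^ n * c" by (rule norm_infsum_le[OF S qc h])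
    ultimately show ?thesis by (simp del: funpow.simps)
  qed
  have "(\<lambda>n. q ^ n * c) \<longlonglongrightarrow> 0"
    using q by (intro tendsto_mult_left_zero LIMSEQ_power_zero) simp
  then have "(\<lambda>n. (\<Sum>\<^sub>\<infinity>e\<in>E. cinner e ((D ^^ (n + 2)) e)) - of_nat (card F)) \<longlonglongrightarrow> 0"
    by (rule Lim_null_comparison[OF always_eventually[OF allI[OF bnd]]])
  then show ?thesis by (simp only: LIM_zero_iff)
qed

section \<open>Dimension of kernel and cokernel\<close>

lemma proj_on_scaleC: "proj_on F (c *\<^sub>C x) = c *\<^sub>C proj_on F (x::'a::complex_inner)"
  by (simp add: proj_on_def cinner_scaleC_right complex_vector.scale_sum_right scaleC_scaleC)

lemma proj_on_sum: "proj_on F (sum g B) = (\<Sum>b\<in>B. proj_on F (g b :: 'a::complex_inner))"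
proof (induction B rule: infinite_finite_induct)
  case (insert b B)
  then show ?case
    by (simp add: proj_on_def cinner_add_right scaleC_add_left sum.distrib)
qed (simp_all add: proj_on_def)

lemma proj_on_in_span: "proj_on F x \<in> complex_vector.span (F :: 'a::complex_inner set)"
  unfolding proj_on_def
  by (simp add: complex_vector.span_sum complex_vector.span_scale complex_vector.span_base)

lemma proj_on_eq_0_iff:
  assumes "orthonormal F" "finite F"
  shows "proj_on F x = 0 \<longleftrightarrow> (\<forall>f\<in>F. cinner f x = 0)"
proof
  assume "proj_on F x = 0"
  then show "\<forall>f\<in>F. cinner f x = 0" using cinner_proj_on[OF assms] by (metis cinner_zero(2))
qed (simp add: proj_on_def)

lemma orthonormal_independent:
  assumes "orthonormal F" "finite F"
  shows "complex_vector.independent F"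
proof (rule complex_vector.independent_if_scalars_zero[OF assms(2)])
  fix c f assume "(\<Sum>x\<in>F. c x *\<^sub>C x) = 0" "f \<in> F"
  then show "c f = 0" using cinner_orthonormal_sum[OF assms, of f c] by simp
qed

lemma dim_orthonormal_basis:
  assumes "orthonormal F" "finite F" "F \<subseteq> V" "\<And>x. x \<in> V \<Longrightarrow> proj_on F x = x"
  shows "complex_vector.dim V = card F"
proof (rule complex_vector.dim_eq_card[OF _ orthonormal_independent[OF assms(1,2)]])
  have "V \<subseteq> complex_vector.span F" using assms(4) proj_on_in_span by (metis subsetI)
  then show "complex_vector.span F = complex_vector.span V"
    unfolding complex_vector.span_eq using assms(3) complex_vector.span_superset by blast
qed

text \<open>The projection onto the span of \<open>F\<close> has this complement as its kernel and
  identifies the quotient with the span. It maps a quotient basis to a basis: existence of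
  coefficients gives spanning, uniqueness gives injectivity and independence.\<close>

lemma quotient_dim_orthogonal_complement:
  fixes F :: "'a::complex_inner set"
  assumes F: "orthonormal F" "finite F"
  shows "quotient_dim {x. \<forall>f\<in>F. cinner f x = 0} = card F"
proof -
  define S where "S = {x. \<forall>f\<in>F. cinner f x = 0}"
  have S: "x \<in> S \<longleftrightarrow> proj_on F x = 0" for x by (simp add: S_def proj_on_eq_0_iff F)
  have pr: "x - (\<Sum>b\<in>B. c b *\<^sub>C b) \<in> S \<longleftrightarrow> proj_on F x = (\<Sum>b\<in>B. c b *\<^sub>C proj_on F b)" for x c B
    by (simp add: S proj_on_diff proj_on_sum proj_on_scaleC)
  have pF: "proj_on F f = f" if "f \<in> F" for f
    using that by (intro proj_on_span F complex_vector.span_base)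
  have "quotient_basis S F"
    unfolding quotient_basis_def
  proof (intro conjI allI)
    fix x
    have eq: "x - (\<Sum>b\<in>F. c b *\<^sub>C b) \<in> S \<longleftrightarrow> (\<forall>b\<in>F. c b = cinner b x)" for c
    proof
      assume "x - (\<Sum>b\<in>F. c b *\<^sub>C b) \<in> S"
      then show "\<forall>b\<in>F. c b = cinner b x"
        by (auto simp: S_def cinner_diff_right cinner_orthonormal_sum[OF F])
    next
      assume "\<forall>b\<in>F. c b = cinner b x"
      then show "x - (\<Sum>b\<in>F. c b *\<^sub>C b) \<in> S"
        by (auto simp: S_def cinner_diff_right cinner_orthonormal_sum[OF F])
    qed
    show "\<exists>!c. c \<in> F \<rightarrow>\<^sub>E (UNIV :: complex set) \<and> x - (\<Sum>b\<in>F. c b *\<^sub>C b) \<in> S"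
      unfolding eq
    proof (rule ex1I[of _ "restrict (\<lambda>b. cinner b x) F"])
      fix c assume "c \<in> F \<rightarrow>\<^sub>E (UNIV :: complex set) \<and> (\<forall>b\<in>F. c b = cinner b x)"
      then show "c = restrict (\<lambda>b. cinner b x) F"
        by (auto simp: fun_eq_iff restrict_def PiE_def extensional_def)
    qed auto
  qed (rule F(2))
  moreover have "card B = card F" if B: "quotient_basis S B" for B
  proof -
    have fin: "finite B" and un: "\<And>x. \<exists>!c. c \<in> B \<rightarrow>\<^sub>E (UNIV :: complex set)
        \<and> proj_on F x = (\<Sum>b\<in>B. c b *\<^sub>C proj_on F b)"
      using B unfolding quotient_basis_def pr by blast+
    \<comment> \<open>Uniqueness of the coefficients of 0. The restriction to \<open>B\<close> is
      there because uniqueness holds among extensional functions only.\<close>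
    have zero: "c b = 0" if "(\<Sum>b\<in>B. c b *\<^sub>C proj_on F b) = 0" "b \<in> B" for c b
    proof -
      have "restrict c B \<in> B \<rightarrow>\<^sub>E (UNIV :: complex set)
          \<and> proj_on F 0 = (\<Sum>b\<in>B. restrict c B b *\<^sub>C proj_on F b)"
        using that(1) by (simp add: proj_on_def)
      moreover have "restrict (\<lambda>_. 0) B \<in> B \<rightarrow>\<^sub>E (UNIV :: complex set)
          \<and> proj_on F 0 = (\<Sum>b\<in>B. restrict (\<lambda>_. 0) B b *\<^sub>C proj_on F b)"
        by (simp add: proj_on_def)
      ultimately have "restrict c B = restrict (\<lambda>_. 0) B" using un[of 0] by blast
      then show ?thesis using that(2) by (metis restrict_apply')
    qed
    have inj: "inj_on (proj_on F) B"
    proof (rule inj_onI, rule ccontr)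
      fix a b assume ab: "a \<in> B" "b \<in> B" "proj_on F a = proj_on F b" "a \<noteq> b"
      \<comment> \<open>The nontrivial relation with coefficient 1 at \<open>a\<close> and -1 at
        \<open>b\<close>.\<close>
      define c where "c x = (if x = a then 1 else 0) - (if x = b then 1 else (0::complex))" for x
      have "c x *\<^sub>C proj_on F x = (if x = a then proj_on F x else 0)
          - (if x = b then proj_on F x else 0)" for x
        by (simp add: c_def scaleC_one scaleC_minus_one)
      then have "(\<Sum>x\<in>B. c x *\<^sub>C proj_on F x) = 0"
        using ab fin by (simp add: sum_subtractf)
      from zero[OF this ab(1)] ab(4) show False by (simp add: c_def)
    qed
    have "complex_vector.independent (proj_on F ` B)"
    proof (rule complex_vector.independent_if_scalars_zero)
      fix c y assume "(\<Sum>x\<in>proj_on F ` B. c x *\<^sub>C x) = 0" "y \<in> proj_on F ` B"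
      then show "c y = 0"
        using zero[of "\<lambda>b. c (proj_on F b)"] by (auto simp: sum.reindex[OF inj])
    qed (use fin in simp)
    moreover have "complex_vector.span (proj_on F ` B) = complex_vector.span F"
      unfolding complex_vector.span_eq
    proof safe
      fix b show "proj_on F b \<in> complex_vector.span F" by (rule proj_on_in_span)
    next
      fix f assume "f \<in> F"
      obtain c where "proj_on F f = (\<Sum>b\<in>B. c b *\<^sub>C proj_on F b)" using un[of f] by blast
      then have "f = (\<Sum>b\<in>B. c b *\<^sub>C proj_on F b)" using pF[OF \<open>f \<in> F\<close>] by simp
      also have "\<dots> \<in> complex_vector.span (proj_on F ` B)"
        by (simp add: complex_vector.span_sum complex_vector.span_scale complex_vector.span_base)
      finally show "f \<in> complex_vector.span (proj_on F ` B)" .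
    qed
    ultimately have "complex_vector.dim F = card (proj_on F ` B)"
      using complex_vector.dim_eq_card by blast
    moreover have "complex_vector.dim F = card F"
      using dim_orthonormal_basis[OF F subset_refl] pF by blast
    ultimately show ?thesis using card_image[OF inj] by simp
  qed
  ultimately show ?thesis
    unfolding quotient_dim_def S_def[symmetric] by (intro the_equality) blast+
qed

section \<open>Trace identities\<close>

text \<open>\<open>trace_op\<close> with the basis as a parameter, so that all operators are visibly
  traced in the same basis.\<close>

definition trace_on :: "'a set \<Rightarrow> ('a::complex_inner \<Rightarrow> 'a) \<Rightarrow> complex" where
  "trace_on E A = (\<Sum>\<^sub>\<infinity>e\<in>E. cinner e (A e))"

lemma trace_on_comm:
  assumes "is_onb E" "adj_pair A A'" "adj_pair B B'" "hilbert_schmidt E A" "hilbert_schmidt E B"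
  shows "trace_on E (\<lambda>x. A (B x)) = trace_on E (\<lambda>x. B (A x))"
  unfolding trace_on_def by (rule hilbert_schmidt_trace(2)[OF assms])

lemma trace_on_diff:
  assumes "(\<lambda>e. cinner e (A e)) summable_on E" "(\<lambda>e. cinner e (B e)) summable_on E"
  shows "trace_on E (\<lambda>x. A x - B x) = trace_on E A - trace_on E B"
  unfolding trace_on_def cinner_diff_right
  using infsum_add[OF assms(1) summable_on_uminus[THEN iffD2, OF assms(2)]] by (simp add: infsum_uminus)

text \<open>The defect of a contraction is positive, hence its own absolute value, and its diagonal
  sum is the Hilbert--Schmidt sum of its square root. The basis provided by
  \<open>trace_class\<close> is then exchanged for \<open>E\<close>.\<close>

lemma trace_class_defect:
  fixes T :: "'a::chilbert_space \<Rightarrow> 'a"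
  assumes T: "adj_pair T T'" and T1: "\<And>x. norm (T x) \<le> norm x"
    and tc: "trace_class (\<lambda>x. x - T' (T x))" and E: "is_onb E"
  obtains R where "adj_pair R R" "\<And>x. R (R x) = x - T' (T x)" "hilbert_schmidt E R"
proof -
  define D where "D = (\<lambda>x. x - T' (T x))"
  note aB = adj_pair_comp[OF adj_pair_sym[OF T] T]
  have aD: "adj_pair D D" unfolding D_def by (rule adj_pair_diff[OF adj_pair_id aB])
  have "cinner x (D x) \<in> \<real>\<^sub>\<ge>\<^sub>0" for x
  proof -
    have "cinner x (D x) = of_real ((norm x)\<^sup>2 - (norm (T x))\<^sup>2)"
      by (simp add: D_def cinner_diff_right adj_pairD(4)[OF T, symmetric] cinner_self)
    then show ?thesis by (simp add: T1 power_mono del: of_real_diff)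
  qed
  then have "positive_op D" using adj_pairD(1)[OF aD] by (simp add: positive_op_def)
  then have "abs_op D = D" by (rule abs_op_positive)
  then obtain G where G: "is_onb G" "(\<lambda>e. cinner e (D e)) summable_on G"
    using tc unfolding trace_class_def D_def by auto
  have "norm (T' (T x)) \<le> norm x" for x
    using adj_pair_norm_le[OF T T1, of "T x"] T1[of x] by linarith
  then obtain R where R: "adj_pair R R" "\<And>x. R (R x) = x - T' (T x)"
    using square_root_one_minus[OF aB] by blast
  have "cinner e (D e) = of_real ((norm (R e))\<^sup>2)" for e
    using adj_pairD(3)[OF R(1), of e "R e"] R(2)[of e] by (simp add: D_def cinner_self)
  then have "(\<lambda>e. complex_of_real ((norm (R e))\<^sup>2)) summable_on G" using G(2) by simp
  then have "(\<lambda>e. Re (complex_of_real ((norm (R e))\<^sup>2))) summable_on G"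
    by (rule summable_on_bounded_linear[OF bounded_linear_Re])
  then have "hilbert_schmidt G R" by (simp add: hilbert_schmidt_def)
  then have "hilbert_schmidt E R" by (rule hilbert_schmidt_adjoint[OF R(1) G(1) E])
  with R show thesis by (rule that)
qed

section \<open>Traces of the two defect operators\<close>

locale defect_pair =
  fixes T T' R S :: "'a::chilbert_space \<Rightarrow> 'a" and E :: "'a set"
  assumes E: "is_onb E" and T: "adj_pair T T'" and T1: "\<And>x. norm (T x) \<le> norm x"
    and R: "adj_pair R R" and RR: "\<And>x. R (R x) = x - T' (T x)" and hsR: "hilbert_schmidt E R"
    and S: "adj_pair S S" and SS: "\<And>x. S (S x) = x - T (T' x)" and hsS: "hilbert_schmidt E S"
begin

text \<open>The assumptions are symmetric under exchanging \<open>T\<close> with \<open>T'\<close>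
  and \<open>R\<close> with \<open>S\<close>, so each fact about \<open>T\<close> also holds for its
  adjoint.\<close>

lemma swap: "defect_pair T' T S R E"
  by unfold_locales (rule E adj_pair_sym[OF T] adj_pair_norm_le[OF T T1] R RR hsR S SS hsS)+

lemmas T' = adj_pair_sym[OF T]
  and blT = bounded_clinearD[OF adj_pairD(1)[OF T]]
  and blT' = bounded_clinearD[OF adj_pairD(2)[OF T]]
  and Tn = adj_pair_funpow[OF T]
  and T'n = adj_pair_funpow[OF adj_pair_sym[OF T]]

abbreviation D where "D \<equiv> \<lambda>x. x - T' (T x)"
abbreviation C where "C \<equiv> \<lambda>x. x - T (T' x)"

lemma D: "adj_pair D D" by (rule adj_pair_diff[OF adj_pair_id adj_pair_comp[OF T' T]])
lemma C: "adj_pair C C" by (rule adj_pair_diff[OF adj_pair_id adj_pair_comp[OF T T']])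

definition curv :: "nat \<Rightarrow> complex" where
  "curv n = trace_on E (\<lambda>x. (T' ^^ n) ((T ^^ n) (x - T (T' x))))"

text \<open>Writing the defect as \<open>S S\<close> and moving one \<open>S\<close> to the front
  exhibits each term as a squared Hilbert--Schmidt norm.\<close>

lemma curv_summable: "(\<lambda>e. cinner e ((T' ^^ n) ((T ^^ n) (C e)))) summable_on E"
  and curv_eq: "curv n = of_real (\<Sum>\<^sub>\<infinity>e\<in>E. (norm ((T ^^ n) (S e)))\<^sup>2)"
  and curv_norm_summable: "(\<lambda>e. (norm ((T ^^ n) (S e)))\<^sup>2) summable_on E"
proof -
  note A = adj_pair_comp[OF T'n[of n] adj_pair_comp[OF Tn[of n] S]]
  note hs1 = hilbert_schmidt_comp_left[OF adj_pairD(1)[OF Tn[of n]] hsS]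
  note hs = hilbert_schmidt_comp_left[OF adj_pairD(1)[OF T'n[of n]] hs1]
  show "(\<lambda>e. cinner e ((T' ^^ n) ((T ^^ n) (C e)))) summable_on E"
    using hilbert_schmidt_trace(1)[OF E A S hs hsS] by (simp add: SS)
  show sm: "(\<lambda>e. (norm ((T ^^ n) (S e)))\<^sup>2) summable_on E"
    using hs1 by (simp add: hilbert_schmidt_def)
  have "curv n = trace_on E (\<lambda>x. S ((T' ^^ n) ((T ^^ n) (S x))))"
    unfolding curv_def SS[symmetric] by (rule trace_on_comm[OF E A S hs hsS])
  also have "\<dots> = (\<Sum>\<^sub>\<infinity>e\<in>E. of_real ((norm ((T ^^ n) (S e)))\<^sup>2))"
    unfolding trace_on_def adj_pairD(3)[OF S, symmetric] adj_pairD(3)[OF T'n, symmetric] cinner_self ..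
  also have "\<dots> = of_real (\<Sum>\<^sub>\<infinity>e\<in>E. (norm ((T ^^ n) (S e)))\<^sup>2)"
    using has_sum_bounded_linear[OF bounded_linear_of_real has_sum_infsum[OF sm]]
    by (rule infsumI)
  finally show "curv n = of_real (\<Sum>\<^sub>\<infinity>e\<in>E. (norm ((T ^^ n) (S e)))\<^sup>2)" .
qed

text \<open>\<open>T\<close> is a contraction, so these squared norms decrease and stay
  nonnegative.\<close>

lemma curv_convergent: "convergent curv"
proof -
  define a where "a n = (\<Sum>\<^sub>\<infinity>e\<in>E. (norm ((T ^^ n) (S e)))\<^sup>2)" for n
  have "decseq a"
    unfolding a_def
    by (intro decseq_SucI infsum_mono curv_norm_summable) (simp add: T1 power_mono)
  moreover have "\<forall>n. 0 \<le> a n" by (simp add: a_def infsum_nonneg)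
  ultimately obtain L where "a \<longlonglongrightarrow> L" by (rule decseq_convergent)
  then have "(\<lambda>n. complex_of_real (a n)) \<longlonglongrightarrow> of_real L" by (rule tendsto_of_real)
  moreover have "curv = (\<lambda>n. complex_of_real (a n))" by (simp add: fun_eq_iff curv_eq a_def)
  ultimately show ?thesis by (auto simp: convergent_def)
qed

text \<open>The difference inserts the defect \<open>D = R R\<close> between the powers of
  \<open>T'\<close> and \<open>T\<close>; cyclicity then moves the front factor
  \<open>(T' ^^ n) R\<close> to the end.\<close>

lemma curv_step:
  "curv n - curv (Suc n) = trace_on E (\<lambda>x. R ((T ^^ n) (S (S ((T' ^^ n) (R x))))))"
proof -
  note A = adj_pair_comp[OF T'n[of n] R]
  note B = adj_pair_comp[OF R adj_pair_comp[OF Tn[of n] adj_pair_comp[OF S S]]]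
  note hsA = hilbert_schmidt_comp_left[OF adj_pairD(1)[OF T'n[of n]] hsR]
  note hsB = hilbert_schmidt_comp_left[OF adj_pairD(1)
      [OF adj_pair_comp[OF R adj_pair_comp[OF Tn[of n] S]]] hsS]
  have "curv n - curv (Suc n)
      = trace_on E (\<lambda>x. (T' ^^ n) ((T ^^ n) (C x)) - (T' ^^ Suc n) ((T ^^ Suc n) (C x)))"
    unfolding curv_def by (rule trace_on_diff[OF curv_summable curv_summable, symmetric])
  also have "(\<lambda>x. (T' ^^ n) ((T ^^ n) (C x)) - (T' ^^ Suc n) ((T ^^ Suc n) (C x)))
      = (\<lambda>x. (T' ^^ n) (R (R ((T ^^ n) (S (S x))))))"
    unfolding RR SS
    by (simp add: fun_eq_iff funpow_swap1 bounded_clinearD(4)[OF adj_pairD(1)[OF T'n]])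
  also have "trace_on E \<dots> = trace_on E (\<lambda>x. R ((T ^^ n) (S (S ((T' ^^ n) (R x))))))"
    by (rule trace_on_comm[OF E A B hsA hsB])
  finally show ?thesis .
qed

text \<open>The left difference is the trace of \<open>D ^^ Suc n\<close> times \<open>T' T\<close>.
  Since \<open>D T' = T' C\<close>, the operator is \<open>T' (C ^^ Suc n) T\<close>, and moving
  \<open>T\<close> to the front gives the right side.\<close>

lemma trace_power_step:
  "trace_on E (D ^^ Suc n) - trace_on E (D ^^ Suc (Suc n))
     = trace_on E (C ^^ Suc n) - trace_on E (C ^^ Suc (Suc n))"
proof -
  note Dn = adj_pair_funpow[OF D] and Cn = adj_pair_funpow[OF C]
  have sD: "(\<lambda>e. cinner e ((D ^^ Suc m) e)) summable_on E" for m
    using hilbert_schmidt_trace(1)[OF E adj_pair_comp[OF Dn[of m] R] R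
        hilbert_schmidt_comp_left[OF adj_pairD(1)[OF Dn[of m]] hsR] hsR]
    by (simp only: RR funpow_Suc_right o_apply)
  have sC: "(\<lambda>e. cinner e ((C ^^ Suc m) e)) summable_on E" for m
    using hilbert_schmidt_trace(1)[OF E adj_pair_comp[OF Cn[of m] S] S
        hilbert_schmidt_comp_left[OF adj_pairD(1)[OF Cn[of m]] hsS] hsS]
    by (simp only: SS funpow_Suc_right o_apply)
  have DT: "(D ^^ m) (T' x) = T' ((C ^^ m) x)" for m x
    by (induction m) (simp_all add: blT')
  note CS = adj_pair_comp[OF Cn[of n] S]
  note A = adj_pair_comp[OF T' CS] and TA = adj_pair_comp[OF T adj_pair_comp[OF T' CS]]
  note B = adj_pair_comp[OF S T]
  note hsCS = hilbert_schmidt_comp_left[OF adj_pairD(1)[OF Cn[of n]] hsS]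
  note hsA = hilbert_schmidt_comp_left[OF adj_pairD(1)[OF T'] hsCS]
  note hsTA = hilbert_schmidt_comp_left[OF adj_pairD(1)[OF T] hsA]
  note hsB = hilbert_schmidt_comp_right[OF E S T hsS]
  have "trace_on E (D ^^ Suc n) - trace_on E (D ^^ Suc (Suc n))
      = trace_on E (\<lambda>x. (D ^^ Suc n) x - (D ^^ Suc (Suc n)) x)"
    by (rule trace_on_diff[OF sD sD, symmetric])
  also have "(\<lambda>x. (D ^^ Suc n) x - (D ^^ Suc (Suc n)) x) = (\<lambda>x. T' ((C ^^ n) (S (S (T x)))))"
  proof
    fix x
    have "(D ^^ Suc n) x - (D ^^ Suc (Suc n)) x = (D ^^ Suc n) x - (D ^^ Suc n) (D x)"
      by (simp only: funpow_Suc_right o_apply)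
    also have "\<dots> = (D ^^ Suc n) (x - D x)"
      by (rule bounded_clinearD(4)[OF adj_pairD(1)[OF Dn], symmetric])
    also have "\<dots> = T' ((C ^^ Suc n) (T x))" by (simp only: DT diff_diff_eq2 add_diff_cancel_left')
    also have "\<dots> = T' ((C ^^ n) (S (S (T x))))" by (simp only: funpow_Suc_right o_apply SS)
    finally show "(D ^^ Suc n) x - (D ^^ Suc (Suc n)) x = T' ((C ^^ n) (S (S (T x))))" .
  qed
  \<comment> \<open>Cyclicity is available for Hilbert--Schmidt factors, so \<open>T\<close> travels
    to the front as part of \<open>S T\<close>, and the extra \<open>S\<close> returns to the end in
    a second move.\<close>
  also have "trace_on E \<dots> = trace_on E (\<lambda>x. S (T (T' ((C ^^ n) (S x)))))"
    by (rule trace_on_comm[OF E A B hsA hsB])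
  also have "\<dots> = trace_on E (\<lambda>x. T (T' ((C ^^ n) (S (S x)))))"
    by (rule trace_on_comm[OF E S TA hsS hsTA])
  also have "(\<lambda>x. T (T' ((C ^^ n) (S (S x))))) = (\<lambda>x. (C ^^ Suc n) x - (C ^^ Suc (Suc n)) x)"
  proof
    fix x
    have "T (T' ((C ^^ n) (S (S x)))) = T (T' ((C ^^ Suc n) x))"
      by (simp only: funpow_Suc_right o_apply SS)
    then show "T (T' ((C ^^ n) (S (S x)))) = (C ^^ Suc n) x - (C ^^ Suc (Suc n)) x"
      by simp
  qed
  also have "trace_on E \<dots> = trace_on E (C ^^ Suc n) - trace_on E (C ^^ Suc (Suc n))"
    by (rule trace_on_diff[OF sC sC])
  finally show ?thesis .
qed

lemma hsD: "hilbert_schmidt E D"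
  using hilbert_schmidt_comp_left[OF adj_pairD(1)[OF R] hsR] by (simp add: RR)

text \<open>The Neumann series describes the range of \<open>T'\<close>, not of \<open>T\<close>;
  the cokernel of \<open>T\<close> comes from the same statement for the swapped pair.\<close>

lemma kernel_data:
  obtains F where "finite F" "orthonormal F" "complex_vector.dim {x. T x = 0} = card F"
    "range T' = {x. \<forall>f\<in>F. cinner f x = 0}"
    "(\<lambda>n. trace_on E (D ^^ (n + 2))) \<longlonglongrightarrow> of_nat (card F)"
proof -
  obtain F where F: "finite F" "orthonormal F" "F \<subseteq> {x. T x = 0}" "\<And>x. T x = 0 \<Longrightarrow> proj_on F x = x"
    using kernel_orthonormal_basis[OF E adj_pairD(1)[OF T] R RR hsR blT'(5)] by blast
  obtain q where q: "0 \<le> q" "q < 1"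
    "\<And>x. (\<And>k. T k = 0 \<Longrightarrow> cinner k x = 0) \<Longrightarrow> norm (D x) \<le> q * norm x"
    using spectral_gap[OF E T T1 refl hsD] by blast
  show thesis
  proof (rule that[OF F(1,2)])
    show "complex_vector.dim {x. T x = 0} = card F"
      by (rule dim_orthonormal_basis[OF F(2,1,3)]) (use F(4) in simp)
    show "(\<lambda>n. trace_on E (D ^^ (n + 2))) \<longlonglongrightarrow> of_nat (card F)"
      unfolding trace_on_def by (rule trace_powers_tendsto[OF E T refl hsD q F])
    show "range T' = {x. \<forall>f\<in>F. cinner f x = 0}"
    proof safe
      fix f x assume "f \<in> F"
      then show "cinner f (T' x) = 0" using F(3) by (auto simp: adj_pairD(4)[OF T, symmetric])
    next
      fix y assume y: "\<forall>f\<in>F. cinner f y = 0"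
      have perp: "cinner k y = 0" if "T k = 0" for k
      proof -
        have "cinner (proj_on F k) y = 0"
          using y by (simp add: proj_on_def cinner_sum_left cinner_scaleC_left)
        then show ?thesis using F(4)[OF that] by simp
      qed
      show "y \<in> range T'" by (rule neumann_range_adjoint(2)[OF T refl q perp])
    qed
  qed
qed

end

lemma (in defect_pair) index_eq_trace:
  "of_int (fredholm_index T) = trace_on E D - trace_on E C"
proof -
  interpret swap: defect_pair T' T S R E by (rule swap)
  obtain F where F: "finite F" "orthonormal F" "complex_vector.dim {x. T x = 0} = card F"
    "range T' = {x. \<forall>f\<in>F. cinner f x = 0}"
    "(\<lambda>n. trace_on E (D ^^ (n + 2))) \<longlonglongrightarrow> of_nat (card F)"
    by (rule kernel_data)
  obtain G where G: "finite G" "orthonormal G" "complex_vector.dim {x. T' x = 0} = card G"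
    "range T = {x. \<forall>f\<in>G. cinner f x = 0}"
    "(\<lambda>n. trace_on E (C ^^ (n + 2))) \<longlonglongrightarrow> of_nat (card G)"
    by (rule swap.kernel_data)
  \<comment> \<open>Exponents start at 1, because the power 0 is the identity, which has no finite
    trace in infinite dimension.\<close>
  have const: "trace_on E (D ^^ Suc n) - trace_on E (C ^^ Suc n) = trace_on E D - trace_on E C" for n
  proof (induction n)
    case (Suc n)
    have "b - d = a - c" if "a - b = c - d" for a b c d :: complex
      using that by algebra
    from this[OF trace_power_step[of n]] Suc show ?case by (rule trans)
  qed (simp add: id_def)
  have "(\<lambda>n. trace_on E (D ^^ (n + 2)) - trace_on E (C ^^ (n + 2)))
      \<longlonglongrightarrow> of_nat (card F) - of_nat (card G)"
    by (rule tendsto_diff[OF F(5) G(5)])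
  then have "trace_on E D - trace_on E C = of_nat (card F) - of_nat (card G)"
    using const by (simp add: LIMSEQ_const_iff del: funpow.simps)
  moreover have "quotient_dim (range T) = card G"
    unfolding G(4) by (rule quotient_dim_orthogonal_complement[OF G(2,1)])
  ultimately show ?thesis by (simp add: fredholm_index_def F(3))
qed

lemma (in defect_pair) index_eq_curv:
  "of_int (fredholm_index T) = lim (defect_pair.curv T' T E) - lim curv"
proof -
  interpret swap: defect_pair T' T S R E by (rule swap)
  \<comment> \<open>With \<open>X = R T\<^sup>n S\<close> the two sides are the traces of
    \<open>X X\<^sup>*\<close> and \<open>X\<^sup>* X\<close>.\<close>
  have step: "curv n - curv (Suc n) = swap.curv n - swap.curv (Suc n)" for n
    unfolding curv_step swap.curv_step
    by (rule trace_on_comm[OF E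
        adj_pair_comp[OF R adj_pair_comp[OF Tn S]] adj_pair_comp[OF S adj_pair_comp[OF T'n R]]
        hilbert_schmidt_comp_left[OF adj_pairD(1)[OF adj_pair_comp[OF R Tn]] hsS]
        hilbert_schmidt_comp_left[OF adj_pairD(1)[OF adj_pair_comp[OF S T'n]] hsR]])
  have "swap.curv n - curv n = swap.curv 0 - curv 0" for n
  proof (induction n)
    case (Suc n)
    have "swap.curv (Suc n) - curv (Suc n)
        = (curv n - curv (Suc n)) - (swap.curv n - swap.curv (Suc n)) + (swap.curv n - curv n)"
      by simp
    then show ?case by (simp add: step Suc)
  qed simp
  \<comment> \<open>At \<open>n = 0\<close> the two terms are the traces of \<open>D\<close> and
    \<open>C\<close>.\<close>
  moreover have "swap.curv 0 - curv 0 = of_int (fredholm_index T)"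
    by (simp add: index_eq_trace curv_def swap.curv_def)
  ultimately have "(\<lambda>n. swap.curv n - curv n) = (\<lambda>_. of_int (fredholm_index T))" by auto
  moreover have "(\<lambda>n. swap.curv n - curv n) \<longlonglongrightarrow> lim swap.curv - lim curv"
    using curv_convergent swap.curv_convergent by (intro tendsto_diff) (simp_all add: convergent_LIMSEQ_iff)
  ultimately show ?thesis by (simp add: LIMSEQ_const_iff)
qed

theorem theorem1:
  fixes T :: "'a::chilbert_space \<Rightarrow> 'a"
  assumes "bounded_clinear T"
    and "onorm T \<le> 1"
    and "almost_unitary T"
  shows "of_int (fredholm_index T) = curvature (cadjoint T) - curvature T"
proof -
  define T' where "T' = cadjoint T"
  have T: "adj_pair T T'" unfolding T'_def by (rule adj_pair_cadjoint[OF assms(1)])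
  have T'': "cadjoint T' = T" by (rule cadjoint_eqI[OF adj_pair_sym[OF T]])
  have T1: "norm (T x) \<le> norm x" for x
    using onorm[OF bounded_clinearD(1)[OF assms(1)], of x] mult_right_mono[OF assms(2), of "norm x"]
    by simp
  have tc: "trace_class (\<lambda>x. x - T' (T x))" "trace_class (\<lambda>x. x - T (T' x))"
    using assms(3) by (simp_all add: almost_unitary_def T'_def)
  \<comment> \<open>The same choice as in \<open>trace_op\<close>, so that \<open>trace_op\<close>
    and \<open>trace_on E\<close> agree by definition. A basis exists because
    \<open>trace_class\<close> asserts one.\<close>
  define E :: "'a set" where "E = (SOME E. is_onb E)"
  have E: "is_onb E" unfolding E_def by (rule someI_ex) (use tc in \<open>auto simp: trace_class_def\<close>)
  obtain R where R: "adj_pair R R" "\<And>x. R (R x) = x - T' (T x)" "hilbert_schmidt E R"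
    using trace_class_defect[OF T T1 tc(1) E] by blast
  obtain S where S: "adj_pair S S" "\<And>x. S (S x) = x - T (T' x)" "hilbert_schmidt E S"
    using trace_class_defect[OF adj_pair_sym[OF T] adj_pair_norm_le[OF T T1] tc(2) E] by blast
  interpret defect_pair T T' R S E
    by unfold_locales (rule E T T1 R S)+
  interpret swap: defect_pair T' T S R E by (rule swap)
  have op: "trace_op A = trace_on E A" for A by (simp add: trace_op_def trace_on_def E_def)
  have "curvature T = lim curv" unfolding curvature_def op curv_def[abs_def] T'_def[symmetric] ..
  moreover have "curvature T' = lim swap.curv" unfolding curvature_def op swap.curv_def[abs_def] T'' ..
  ultimately show ?thesis using index_eq_curv by (simp add: T'_def)
qed

end
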